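(* Let $E$ be a Banach function space (BFS) on $\mathbb{R}^n$ with absolutely continuous norm. Let $\mathcal{F}\subset E$ be a family satisfying the following conditions: (a) $\mathcal{F}$ is bounded, i.e. $\sup_{f\in\mathcal{F}}\|f\|_E<\infty$; (b) $\mathcal{F}$ uniformly vanishes at infinity, that is, $\lim_{N\to\infty}\sup_{f\in\mathcal{F}}\|f\chi_{B^c(0,N)}\|_E=0$; (c) $\mathcal{F}$ is equicontinuous, that is, $\lim_{r\to0}\sup_{f\in\mathcal{F}}\sup_{y\in B(0,r)}\|\tau_yf-f\|_E=0$. Then $\mathcal{F}$ is a totally bounded subset of $E$.
   Context: Let $m$ be Lebesgue measure on $\mathbb{R}^n$ and let $L(m)$ be the class of Lebesgue measurable functions on $\mathbb{R}^n$ (functions equal a.e. are identified). $B(0,r)$ is the open Euclidean ball of radius $r$ centered at $0$, $B^c(0,N)=\mathbb{R}^n\setminus B(0,N)$, $\chi_A$ is the indicator function of $A$, and $\tau_yf(x)=f(x-y)$. A Banach function space (BFS) is a normed space $(E,\|\cdot\|_E)$ with $E\subset L(m)$ such that (with the convention that $\|f\|_E$ is defined in $[0,\infty]$ for all $f\in L(m)$ and $f\in E$ if and only if $\|f\|_E<\infty$): (B0) $\|f\|_E=0$ if and only if $f=0$ a.e.; (B1) $\||f|\|_E=\|f\|_E$; (B2) if $0\le g\le f$ a.e., then $\|g\|_E\le\|f\|_E$; (B3) if $0\le f_n\uparrow f$ a.e., then $\|f_n\|_E\uparrow\|f\|_E$; (B4) if $A\subset\mathbb{R}^n$ is a bounded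 measurable set, then $\chi_A\in E$. (Elements of $E$ are then finite a.e., and $E$ is complete.) No inequality of the form $\int_A|f|\,dx\le C(A)\|f\|_E$ is assumed. $E$ has absolutely continuous norm if for every $f\in E$ and every sequence of measurable sets $A_k$ with $A_k\to\emptyset$ (i.e. $\chi_{A_k}\to0$ a.e.) one has $\|f\chi_{A_k}\|_E\to0$. *)

theory Defs
  imports "HOL-Analysis.Analysis"
begin

text \<open>
  Scalars are any type \<open>'s\<close> that is both a normed field and a Euclidean space; this covers real- and
  complex-valued functions uniformly. Nonnegative functions are real-valued functions composed with
  \<open>of_real\<close>.

  Functions equal almost everywhere are not quotiented. The axioms \<open>B1\<close> and \<open>B2\<close> force \<open>nrm f = nrm g\<close>
  whenever measurable \<open>f\<close> and \<open>g\<close> agree almost everywhere. Since elements of a Banach function space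
  are finite almost everywhere, only finite-valued representatives are used.
\<close>

definition BFS_carrier :: "((real ^ 'n \<Rightarrow> 's) \<Rightarrow> ennreal) \<Rightarrow>
    (real ^ 'n \<Rightarrow> 's :: {real_normed_field, euclidean_space}) set"
  where "BFS_carrier nrm = {f \<in> borel_measurable lebesgue. nrm f < \<infinity>}"

text \<open>
  The values of \<open>nrm\<close> on non-measurable functions are unconstrained and never used.
  In \<open>B3\<close> a limit that is infinite on a set \<open>A\<close> of positive measure need not be treated separately:
  applying \<open>B3\<close> to \<open>min (f\<^sub>n x) k\<close> restricted to \<open>A\<close> shows that \<open>nrm f\<^sub>n\<close> is unbounded.
\<close>

locale banach_function_space =
  fixes nrm :: "(real ^ 'n \<Rightarrow> 's :: {real_normed_field, euclidean_space}) \<Rightarrow> ennreal"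
  assumes scale: "\<And>c f. f \<in> BFS_carrier nrm \<Longrightarrow> nrm (\<lambda>x. c * f x) = ennreal (norm c) * nrm f"
    and triangle: "\<And>f g. f \<in> BFS_carrier nrm \<Longrightarrow> g \<in> BFS_carrier nrm \<Longrightarrow>
          nrm (\<lambda>x. f x + g x) \<le> nrm f + nrm g"
    and B0: "\<And>f. f \<in> borel_measurable lebesgue \<Longrightarrow> nrm f = 0 \<longleftrightarrow> (AE x in lebesgue. f x = 0)"
    and B1: "\<And>f. f \<in> borel_measurable lebesgue \<Longrightarrow> nrm (\<lambda>x. of_real (norm (f x))) = nrm f"
    and B2: "\<And>f g :: real ^ 'n \<Rightarrow> real.
          f \<in> borel_measurable lebesgue \<Longrightarrow> g \<in> borel_measurable lebesgue \<Longrightarrow>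
          (AE x in lebesgue. 0 \<le> g x \<and> g x \<le> f x) \<Longrightarrow>
          nrm (\<lambda>x. of_real (g x)) \<le> nrm (\<lambda>x. of_real (f x))"
    and B3: "\<And>(f :: nat \<Rightarrow> real ^ 'n \<Rightarrow> real) (g :: real ^ 'n \<Rightarrow> real).
          (\<And>k. f k \<in> borel_measurable lebesgue) \<Longrightarrow> g \<in> borel_measurable lebesgue \<Longrightarrow>
          (AE x in lebesgue. (\<forall>k. 0 \<le> f k x) \<and> incseq (\<lambda>k. f k x) \<and> (\<lambda>k. f k x) \<longlonglongrightarrow> g x) \<Longrightarrow>
          incseq (\<lambda>k. nrm (\<lambda>x. of_real (f k x))) \<and>
          (\<lambda>k. nrm (\<lambda>x. of_real (f k x))) \<longlonglongrightarrow> nrm (\<lambda>x. of_real (g x))"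
    and B4: "\<And>A. A \<in> sets lebesgue \<Longrightarrow> bounded A \<Longrightarrow> indicator A \<in> BFS_carrier nrm"

definition absolutely_continuous_norm ::
    "((real ^ 'n \<Rightarrow> 's :: {real_normed_field, euclidean_space}) \<Rightarrow> ennreal) \<Rightarrow> bool"
  where "absolutely_continuous_norm nrm \<longleftrightarrow>
    (\<forall>f \<in> BFS_carrier nrm. \<forall>A :: nat \<Rightarrow> (real ^ 'n) set.
       (\<forall>k. A k \<in> sets lebesgue) \<longrightarrow>
       (AE x in lebesgue. (\<lambda>k. indicator (A k) x :: real) \<longlonglongrightarrow> 0) \<longrightarrow>
       (\<lambda>k. nrm (\<lambda>x. f x * indicator (A k) x)) \<longlonglongrightarrow> 0)"

definition translate :: "real ^ 'n \<Rightarrow> (real ^ 'n \<Rightarrow> 's) \<Rightarrow> real ^ 'n \<Rightarrow> 's"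
  where "translate y f = (\<lambda>x. f (x - y))"

text \<open>
  This is \<open>Metric_space.mtotally_bounded\<close> for the distance \<open>nrm (f - g)\<close>, written out because that
  distance is only a pseudometric on functions.
\<close>

definition BFS_totally_bounded ::
    "((real ^ 'n \<Rightarrow> 's :: {real_normed_field, euclidean_space}) \<Rightarrow> ennreal) \<Rightarrow>
     (real ^ 'n \<Rightarrow> 's) set \<Rightarrow> bool"
  where "BFS_totally_bounded nrm F \<longleftrightarrow> F \<subseteq> BFS_carrier nrm \<and>
    (\<forall>\<epsilon>::real. \<epsilon> > 0 \<longrightarrow>
      (\<exists>K. finite K \<and> K \<subseteq> F \<and> (\<forall>f\<in>F. \<exists>g\<in>K. nrm (\<lambda>x. f x - g x) < ennreal \<epsilon>)))"

end

theory Submission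
  imports Defs
begin

text \<open>
  Elements of \<open>E\<close> need not be locally integrable, so convolution is unavailable, and Minkowski's integral
  inequality is replaced by a discrete argument. Let \<open>f \<in> F\<close> and let \<open>c\<^sub>j\<close> be a median of \<open>f\<close> on a small
  ball \<open>B\<^sub>j\<close>. For \<open>x \<in> B\<^sub>j\<close>, at least half of the points \<open>x - y \<in> B\<^sub>j\<close> satisfy
  \<open>|f x - c\<^sub>j| \<le> 2 |f x - f (x - y)| + 2 \<epsilon>\<close>. One can choose \<open>y\<^sub>1, \<dots>, y\<^sub>m\<close> such that outside a set of arbitrarily
  small measure each \<open>x\<close> enjoys this inequality for a fixed proportion of the \<open>y\<^sub>i\<close>. Averaging
  over \<open>i\<close> bounds \<open>f - \<Sum>\<^sub>j c\<^sub>j \<chi>\<close> by a constant, depending only on the dimension, times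
  \<open>sup \<parallel>\<tau>\<^sub>y f - f\<parallel>\<close>; the exceptional set costs nothing because the norm is absolutely continuous. Hence \<open>F\<close>
  lies close to a bounded subset of a finite-dimensional space of step functions.
\<close>

section \<open>Approximate medians of vector-valued functions\<close>

text \<open>\<open>c\<close> is the centre of a ball with almost minimal radius \<open>R\<close> among those capturing half of the mass of \<open>f\<close>.
  If \<open>v\<close> is far from \<open>c\<close>, the captured half is far from \<open>v\<close>; otherwise, by minimality of \<open>R\<close>, half of
  the mass has distance about \<open>R\<close> from \<open>v\<close>.\<close>

lemma approximate_median:
  fixes f :: "'a \<Rightarrow> 'b::euclidean_space"
  assumes [measurable]: "f \<in> borel_measurable M" "Q \<in> sets M"
    and fin: "emeasure M Q < \<infinity>" and "\<epsilon> > 0"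
  obtains c where "\<And>v. emeasure M Q \<le> 2 * emeasure M {z \<in> Q. dist v c \<le> 2 * dist v (f z) + 2 * \<epsilon>}"
proof -
  \<comment> \<open>Only multiples of \<open>\<epsilon>\<close> compete as radii, so that a least
    one exists. The loss of one step \<open>\<epsilon>\<close> is the source of the summand
    \<open>2 * \<epsilon>\<close>.\<close>
  define P where "P k \<longleftrightarrow> (\<exists>c. emeasure M Q \<le> 2 * emeasure M {z \<in> Q. dist (f z) c \<le> \<epsilon> * real k})" for k
  have QM: "{z \<in> Q. R z} = {z \<in> space M. z \<in> Q \<and> R z}" for R
    using sets.sets_into_space[OF assms(2)] by auto
  have meas: "{z \<in> Q. dist (f z) c \<le> r} \<in> sets M" "{z \<in> Q. r < dist (f z) c} \<in> sets M" for c r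
    unfolding QM by measurable
  have "\<exists>k. P k"
  proof (cases "emeasure M Q = 0")
    case False
    \<comment> \<open>Balls around 0 exhaust \<open>Q\<close>, so continuity from below yields one
      that carries more than half of the mass.\<close>
    define B where "B k = {z \<in> Q. dist (f z) 0 \<le> \<epsilon> * real k}" for k
    have "(\<lambda>k. emeasure M (B k)) \<longlonglongrightarrow> emeasure M (\<Union>k. B k)"
    proof (rule Lim_emeasure_incseq)
      show "incseq B"
        unfolding B_def incseq_def using \<open>\<epsilon> > 0\<close> by (auto intro: order_trans mult_left_mono)
    qed (use meas in \<open>auto simp: B_def\<close>)
    also have "(\<Union>k. B k) = Q"
    proof -
      have "\<exists>k. dist (f z) 0 \<le> \<epsilon> * real k" for z
        using real_arch_simple[of "dist (f z) 0 / \<epsilon>"] \<open>\<epsilon> > 0\<close> by (auto simp: field_simps)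
      then show ?thesis by (auto simp: B_def)
    qed
    finally have "(\<lambda>k. emeasure M (B k)) \<longlonglongrightarrow> emeasure M Q" .
    moreover obtain a where a: "emeasure M Q = ennreal a" "a > 0"
      using False fin by (cases "emeasure M Q") (auto simp: less_le)
    ultimately have "eventually (\<lambda>k. ennreal (a / 2) < emeasure M (B k)) sequentially"
      by (intro order_tendstoD(1)) (auto simp: ennreal_less_iff)
    then obtain k where "ennreal (a / 2) < emeasure M (B k)"
      by (auto simp: eventually_sequentially)
    then have "2 * ennreal (a / 2) \<le> 2 * emeasure M (B k)"
      by (intro mult_left_mono) auto
    also have "2 * ennreal (a / 2) = emeasure M Q"
      unfolding a(1) using a(2) by (simp flip: ennreal_mult ennreal_numeral)
    finally have "emeasure M Q \<le> 2 * emeasure M (B k)" .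
    then show ?thesis
      unfolding P_def B_def by blast
  qed (auto simp: P_def)
  define k where "k = (LEAST k. P k)"
  have "P k" unfolding k_def using \<open>\<exists>k. P k\<close> by (rule LeastI_ex)
  then obtain c where c: "emeasure M Q \<le> 2 * emeasure M {z \<in> Q. dist (f z) c \<le> \<epsilon> * real k}"
    unfolding P_def by blast
  have "emeasure M Q \<le> 2 * emeasure M {z \<in> Q. dist v c \<le> 2 * dist v (f z) + 2 * \<epsilon>}" (is "_ \<le> 2 * emeasure M ?G") for v
  proof -
    have G: "?G \<in> sets M" unfolding QM by measurable
    show ?thesis
    proof (cases "dist v c \<le> 2 * \<epsilon> * real k")
      case False
      have "emeasure M {z \<in> Q. dist (f z) c \<le> \<epsilon> * real k} \<le> emeasure M ?G"
      proof (intro emeasure_mono G subsetI)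
        fix z assume "z \<in> {z \<in> Q. dist (f z) c \<le> \<epsilon> * real k}"
        moreover have "dist v c \<le> dist v (f z) + dist (f z) c" by (rule dist_triangle)
        ultimately show "z \<in> ?G" using False \<open>\<epsilon> > 0\<close> by auto
      qed
      then show ?thesis using c by (meson mult_left_mono order_trans zero_le)
    next
      case True
      show ?thesis
      proof (cases k)
        case 0
        \<comment> \<open>With \<open>k = 0\<close> the case assumption gives
          \<open>dist v c \<le> 0\<close>, so the inequality defining \<open>?G\<close> is
          trivial.\<close>
        then have "?G = Q" using True \<open>\<epsilon> > 0\<close> by (auto intro: order_trans[OF _ add_nonneg_nonneg])
        show ?thesis unfolding \<open>?G = Q\<close> by (simp add: mult_2)
      next
        case (Suc j)
        \<comment> \<open>No centre, in particular not \<open>v\<close>, captures half of the mass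
          within \<open>\<epsilon> * real j\<close>. So \<open>?U\<close> carries more than half,
          and there \<open>dist v c \<le> 2 * \<epsilon> * (j + 1) \<le> 2 * dist v (f z) + 2 *
          \<epsilon>\<close>.\<close>
        let ?L = "{z \<in> Q. dist (f z) v \<le> \<epsilon> * real j}" and ?U = "{z \<in> Q. \<epsilon> * real j < dist (f z) v}"
        have "\<not> P j" using Suc not_less_Least[of j P] unfolding k_def by simp
        then have L: "2 * emeasure M ?L < emeasure M Q"
          unfolding P_def by (auto simp: not_le)
        have "emeasure M Q = emeasure M ?L + emeasure M ?U"
          by (subst plus_emeasure) (auto intro!: meas arg_cong[where f="emeasure M"])
        moreover have "emeasure M ?U \<le> emeasure M ?G"
          using True Suc \<open>\<epsilon> > 0\<close> by (intro emeasure_mono G) (auto simp: dist_commute algebra_simps)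
        ultimately have *: "emeasure M Q \<le> emeasure M ?L + emeasure M ?G"
          by (simp add: add_left_mono)
        have "2 * emeasure M Q \<le> 2 * emeasure M ?L + 2 * emeasure M ?G"
          using mult_left_mono[OF *, of 2] by (simp add: distrib_left)
        also have "\<dots> \<le> emeasure M Q + 2 * emeasure M ?G"
          using L by (intro add_right_mono) auto
        finally have "emeasure M Q + emeasure M Q \<le> emeasure M Q + 2 * emeasure M ?G"
          unfolding mult_2[of "emeasure M Q"] .
        then show ?thesis
          using fin unfolding ennreal_add_left_cancel_le by auto
      qed
    qed
  qed
  then show ?thesis by (rule that)
qed

section \<open>Finitely many points that hit most sections often\<close>

text \<open>By Fubini the mean over \<open>y\<close> in \<open>D\<close> of the weight that is hit
  is at least \<open>2 * q\<close> times the total weight, so some \<open>y\<close> reaches the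
  fraction \<open>q\<close>. The spare factor 2 yields the contradiction without strict inequalities
  between integrals.\<close>

lemma frequently_hit_point:
  fixes q :: real
  assumes [measurable]: "w \<in> borel_measurable M" "D \<in> sets M" "H \<in> sets (M \<Otimes>\<^sub>M M)"
    and "sigma_finite_measure M"
    and D: "0 < emeasure M D" "emeasure M D < \<infinity>" and W: "(\<integral>\<^sup>+x. w x \<partial>M) < \<infinity>" and "q > 0"
    and H: "\<And>x. x \<in> space M \<Longrightarrow> w x \<noteq> 0 \<Longrightarrow> ennreal (2 * q) * emeasure M D \<le> emeasure M {y \<in> D. (x, y) \<in> H}"
  obtains y where "y \<in> D" "ennreal q * (\<integral>\<^sup>+x. w x \<partial>M) \<le> (\<integral>\<^sup>+x. w x * indicator H (x, y) \<partial>M)"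
proof -
  have "\<exists>y\<in>D. ennreal q * (\<integral>\<^sup>+x. w x \<partial>M) \<le> (\<integral>\<^sup>+x. w x * indicator H (x, y) \<partial>M)"
  proof (rule ccontr)
    assume "\<not> ?thesis"
    then have neg: "(\<integral>\<^sup>+x. w x * indicator H (x, y) \<partial>M) < ennreal q * (\<integral>\<^sup>+x. w x \<partial>M)" if "y \<in> D" for y
      using that by (meson not_le)
    interpret sigma_finite_measure M by fact
    interpret P: pair_sigma_finite M M ..
    let ?W = "\<integral>\<^sup>+x. w x \<partial>M"
    have "D \<noteq> {}" using D by auto
    then have "?W > 0" using neg by (metis ex_in_conv gr_zeroI mult_zero_right not_less_zero)
    have sec: "{y \<in> D. (x, y) \<in> H} \<in> sets M" if "x \<in> space M" for x
    proof -
      have "{y \<in> D. (x, y) \<in> H} = {y \<in> space M. y \<in> D \<and> (x, y) \<in> H}"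
        using sets.sets_into_space[OF assms(2)] by auto
      also have "\<dots> \<in> sets M" using that by measurable
      finally show ?thesis .
    qed
    \<comment> \<open>One double integral is bounded below by integrating first over
      \<open>y\<close>, using the hypothesis on sections of \<open>H\<close>, and above by
      integrating first over \<open>x\<close>, using \<open>neg\<close>.\<close>
    have "ennreal (2 * q) * emeasure M D * ?W = (\<integral>\<^sup>+x. w x * (ennreal (2 * q) * emeasure M D) \<partial>M)"
      by (simp add: nn_integral_multc mult.commute)
    also have "\<dots> \<le> (\<integral>\<^sup>+x. w x * emeasure M {y \<in> D. (x, y) \<in> H} \<partial>M)"
    proof (rule nn_integral_mono)
      fix x assume "x \<in> space M"
      then show "w x * (ennreal (2 * q) * emeasure M D) \<le> w x * emeasure M {y \<in> D. (x, y) \<in> H}"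
        using H[of x] by (cases "w x = 0") (auto intro: mult_left_mono)
    qed
    also have "\<dots> = (\<integral>\<^sup>+x. (\<integral>\<^sup>+y. w x * (indicator D y * indicator H (x, y)) \<partial>M) \<partial>M)"
    proof (rule nn_integral_cong)
      fix x assume x: "x \<in> space M"
      have "emeasure M {y \<in> D. (x, y) \<in> H} = (\<integral>\<^sup>+y. indicator D y * indicator H (x, y) \<partial>M)"
        by (subst nn_integral_indicator[symmetric, OF sec[OF x]])
          (auto intro!: nn_integral_cong simp: indicator_def)
      then show "w x * emeasure M {y \<in> D. (x, y) \<in> H} = (\<integral>\<^sup>+y. w x * (indicator D y * indicator H (x, y)) \<partial>M)"
        using x by (subst nn_integral_cmult) (auto)
    qed
    also have "\<dots> = (\<integral>\<^sup>+y. (\<integral>\<^sup>+x. w x * (indicator D y * indicator H (x, y)) \<partial>M) \<partial>M)"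
      by (rule P.Fubini'[symmetric]) measurable
    also have "\<dots> \<le> (\<integral>\<^sup>+y. (ennreal q * ?W) * indicator D y \<partial>M)"
    proof (rule nn_integral_mono)
      fix y assume "y \<in> space M"
      show "(\<integral>\<^sup>+x. w x * (indicator D y * indicator H (x, y)) \<partial>M) \<le> (ennreal q * ?W) * indicator D y"
        using neg[of y] by (auto simp: indicator_def[of D])
    qed
    also have "\<dots> = ennreal q * ?W * emeasure M D"
      by (simp add: nn_integral_cmult_indicator)
    finally have "ennreal (2 * q) * emeasure M D * ?W \<le> ennreal q * ?W * emeasure M D" .
    moreover obtain a b where "emeasure M D = ennreal a" "a > 0" "?W = ennreal b" "b > 0"
      using D W \<open>?W > 0\<close> by (metis ennreal_cases ennreal_less_zero_iff infinity_ennreal_def less_irrefl)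
    ultimately show False using \<open>q > 0\<close> by (simp flip: ennreal_mult)
  qed
  then show thesis using that by blast
qed

text \<open>The points are chosen greedily, each one decreasing the potential
  \<open>\<integral>\<^sub>A 2\<^bsup>- hits x\<^esup> dx\<close> by a factor \<open>1 - q / 2\<close>.\<close>

lemma greedy_potential_bound:
  fixes q :: real
  assumes [measurable]: "A \<in> sets M" "D \<in> sets M" "H \<in> sets (M \<Otimes>\<^sub>M M)"
    and "sigma_finite_measure M"
    and D: "0 < emeasure M D" "emeasure M D < \<infinity>" and A: "emeasure M A < \<infinity>" and q: "0 < q" "q \<le> 1"
    and H: "\<And>x. x \<in> A \<Longrightarrow> ennreal (2 * q) * emeasure M D \<le> emeasure M {y \<in> D. (x, y) \<in> H}"
  shows "\<exists>ys. (\<forall>i<m. ys i \<in> D) \<and>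
    (\<integral>\<^sup>+x. indicator A x * (\<Prod>i<m. if (x, ys i) \<in> H then ennreal (1/2) else 1) \<partial>M) \<le> ennreal ((1 - q / 2) ^ m) * emeasure M A"
proof (induction m)
  case (Suc m)
  then obtain ys where ys: "\<And>i. i < m \<Longrightarrow> ys i \<in> D"
    and le: "(\<integral>\<^sup>+x. indicator A x * (\<Prod>i<m. if (x, ys i) \<in> H then ennreal (1/2) else 1) \<partial>M) \<le> ennreal ((1 - q / 2) ^ m) * emeasure M A"
    by blast
  let ?w = "\<lambda>x. indicator A x * (\<Prod>i<m. if (x, ys i) \<in> H then ennreal (1/2) else 1) :: ennreal"
  have ysp: "ys i \<in> space M" if "i < m" for i using ys[OF that] sets.sets_into_space[OF assms(2)] by auto
  have fac[measurable]: "(\<lambda>x. if (x, y) \<in> H then ennreal (1/2) else 1 :: ennreal) \<in> borel_measurable M" if "y \<in> space M" for y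
    using that by measurable
  have w[measurable]: "?w \<in> borel_measurable M"
    using ysp by measurable
  have W: "(\<integral>\<^sup>+x. ?w x \<partial>M) < \<infinity>"
    using le A by (auto simp: ennreal_mult_less_top intro: le_less_trans)
  \<comment> \<open>The weight is the current potential density, so the new point hits a fraction
    \<open>q\<close> of what is left rather than of \<open>A\<close>.\<close>
  obtain y where y: "y \<in> D" "ennreal q * (\<integral>\<^sup>+x. ?w x \<partial>M) \<le> (\<integral>\<^sup>+x. ?w x * indicator H (x, y) \<partial>M)"
  proof (rule frequently_hit_point[OF w assms(2,3) assms(4) D W q(1)])
    fix x assume "?w x \<noteq> 0"
    then have "x \<in> A" by (auto simp: indicator_def split: if_splits)
    then show "ennreal (2 * q) * emeasure M D \<le> emeasure M {y \<in> D. (x, y) \<in> H}" by (rule H)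
  qed blast
  have yS: "y \<in> space M" using y(1) sets.sets_into_space[OF assms(2)] by auto
  let ?w' = "\<lambda>x. indicator A x * (\<Prod>i<Suc m. if (x, (ys(m := y)) i) \<in> H then ennreal (1/2) else 1) :: ennreal"
  have prod: "(\<Prod>i<m. if (x, (ys(m := y)) i) \<in> H then ennreal (1/2) else 1 :: ennreal) = (\<Prod>i<m. if (x, ys i) \<in> H then ennreal (1/2) else 1)" for x
    by (intro prod.cong) auto
  have w'_eq: "?w' x = ?w x * (if (x, y) \<in> H then ennreal (1/2) else 1)" for x
    by (simp add: prod mult.assoc)
  have half: "a * inverse 2 + inverse 2 * a = a" for a :: ennreal
  proof -
    have "inverse 2 + inverse 2 = (1 :: ennreal)"
      unfolding ennreal_half[symmetric] by (subst ennreal_plus[symmetric]) auto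
    then show ?thesis
      by (metis distrib_left mult.commute mult_1_right)
  qed
  have w': "?w' \<in> borel_measurable M"
    unfolding w'_eq by (intro borel_measurable_times_ennreal w fac[OF yS])
  \<comment> \<open>A hit halves the weight, so the loss of potential is exactly half of the weight
    sitting on the section of \<open>H\<close> at \<open>y\<close>.\<close>
  have "(\<integral>\<^sup>+x. ?w x \<partial>M) = (\<integral>\<^sup>+x. ?w' x + ennreal (1/2) * (?w x * indicator H (x, y)) \<partial>M)"
    unfolding w'_eq
    by (intro nn_integral_cong) (auto simp: half)
  also have "\<dots> = (\<integral>\<^sup>+x. ?w' x \<partial>M) + ennreal (1/2) * (\<integral>\<^sup>+x. ?w x * indicator H (x, y) \<partial>M)"
  proof -
    have m: "(\<lambda>x. ?w x * indicator H (x, y)) \<in> borel_measurable M"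
      using yS by measurable
    show ?thesis
      by (subst nn_integral_add[OF w' borel_measurable_times_ennreal[OF borel_measurable_const m]],
          subst nn_integral_cmult[OF m]) (rule refl)
  qed
  finally have eq: "(\<integral>\<^sup>+x. ?w x \<partial>M) = (\<integral>\<^sup>+x. ?w' x \<partial>M) + ennreal (1/2) * (\<integral>\<^sup>+x. ?w x * indicator H (x, y) \<partial>M)" .
  have "(\<integral>\<^sup>+x. ?w' x \<partial>M) + ennreal (1/2) * (ennreal q * (\<integral>\<^sup>+x. ?w x \<partial>M)) \<le>
      (\<integral>\<^sup>+x. ?w' x \<partial>M) + ennreal (1/2) * (\<integral>\<^sup>+x. ?w x * indicator H (x, y) \<partial>M)"
    by (intro add_left_mono mult_left_mono y(2)) simp
  also have "\<dots> = (\<integral>\<^sup>+x. ?w x \<partial>M)"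
    by (rule eq[symmetric])
  finally have "(\<integral>\<^sup>+x. ?w' x \<partial>M) + ennreal (1/2) * (ennreal q * (\<integral>\<^sup>+x. ?w x \<partial>M)) \<le> (\<integral>\<^sup>+x. ?w x \<partial>M)" .
  \<comment> \<open>Passing to real values permits the subtraction behind the factor
    \<open>1 - q / 2\<close>.\<close>
  moreover obtain a where a: "(\<integral>\<^sup>+x. ?w x \<partial>M) = ennreal a" "a \<ge> 0"
    using W by (cases "\<integral>\<^sup>+x. ?w x \<partial>M") auto
  moreover obtain b where b: "(\<integral>\<^sup>+x. ?w' x \<partial>M) = ennreal b" "b \<ge> 0"
    using calculation by (cases "\<integral>\<^sup>+x. ?w' x \<partial>M") (auto simp: top_unique)
  ultimately have "ennreal b + ennreal (1/2) * (ennreal q * ennreal a) \<le> ennreal a"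
    by simp
  then have "b + 1/2 * (q * a) \<le> a"
    using q a(2) b(2) by (simp del: ennreal_half flip: ennreal_mult ennreal_plus)
  then have "(\<integral>\<^sup>+x. ?w' x \<partial>M) \<le> ennreal (1 - q / 2) * (\<integral>\<^sup>+x. ?w x \<partial>M)"
    using q a b by (simp add: algebra_simps flip: ennreal_mult)
  also have "\<dots> \<le> ennreal (1 - q / 2) * (ennreal ((1 - q / 2) ^ m) * emeasure M A)"
    by (intro mult_left_mono le) auto
  also have "\<dots> = ennreal ((1 - q / 2) ^ Suc m) * emeasure M A"
    using q by (simp add: ennreal_mult mult.assoc)
  finally show ?case
    using ys y(1) by (intro exI[of _ "ys(m := y)"]) (auto simp: less_Suc_eq)
qed (auto)

text \<open>A point with fewer than \<open>k\<close> hits keeps weight at least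
  \<open>(1/2)^k\<close>, whereas by the choice of \<open>L\<close> the potential after
  \<open>L * k\<close> rounds is at most \<open>(1/4)^k\<close> times the measure of
  \<open>A\<close>. Markov's inequality leaves the factor \<open>(1/2)^k\<close>, which is summable
  in \<open>k\<close> as needed for Borel-Cantelli.\<close>

lemma frequent_hits:
  fixes q :: real
  assumes [measurable]: "A \<in> sets M" "D \<in> sets M" "H \<in> sets (M \<Otimes>\<^sub>M M)"
    and "sigma_finite_measure M"
    and "0 < emeasure M D" "emeasure M D < \<infinity>" and A: "emeasure M A < \<infinity>" and q: "0 < q" "q \<le> 1"
    and "\<And>x. x \<in> A \<Longrightarrow> ennreal (2 * q) * emeasure M D \<le> emeasure M {y \<in> D. (x, y) \<in> H}"
    and L: "(1 - q / 2) ^ L \<le> 1 / 4"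
  shows "\<exists>ys. (\<forall>i<L * k. ys i \<in> D) \<and> {x \<in> A. card {i. i < L * k \<and> (x, ys i) \<in> H} < k} \<in> sets M \<and>
    emeasure M {x \<in> A. card {i. i < L * k \<and> (x, ys i) \<in> H} < k} \<le> ennreal ((1 / 2) ^ k) * emeasure M A"
proof -
  let ?m = "L * k"
  obtain ys where ys: "\<And>i. i < ?m \<Longrightarrow> ys i \<in> D"
    and le: "(\<integral>\<^sup>+x. indicator A x * (\<Prod>i<?m. if (x, ys i) \<in> H then ennreal (1/2) else 1) \<partial>M) \<le> ennreal ((1 - q / 2) ^ ?m) * emeasure M A"
    using greedy_potential_bound[OF assms(1-10), of ?m] by blast
  define B where "B = {x \<in> A. card {i. i < ?m \<and> (x, ys i) \<in> H} < k}"
  have ysp: "ys i \<in> space M" if "i < ?m" for i using ys[OF that] sets.sets_into_space[OF assms(2)] by auto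
  have B_eq: "B = {x \<in> space M. x \<in> A \<and> (\<Sum>i<?m. if (x, ys i) \<in> H then 1 else 0 :: nat) < k}"
  proof -
    have "card {i. i < ?m \<and> (x, ys i) \<in> H} = (\<Sum>i<?m. if (x, ys i) \<in> H then 1 else 0)" for x
      by (simp add: sum.If_cases Int_def)
    then show ?thesis unfolding B_def using sets.sets_into_space[OF assms(1)] by auto
  qed
  have [measurable]: "(\<lambda>x. if (x, y) \<in> H then 1 else 0 :: nat) \<in> measurable M (count_space UNIV)" if "y \<in> space M" for y
    using that by measurable
  have "B \<in> sets M"
    unfolding B_eq using ysp by measurable
  have "ennreal ((1/2)^k) * emeasure M B = (\<integral>\<^sup>+x. ennreal ((1/2)^k) * indicator B x \<partial>M)"
    using \<open>B \<in> sets M\<close> by (rule nn_integral_cmult_indicator[symmetric])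
  also have "\<dots> \<le> (\<integral>\<^sup>+x. indicator A x * (\<Prod>i<?m. if (x, ys i) \<in> H then ennreal (1/2) else 1) \<partial>M)"
  proof (rule nn_integral_mono)
    fix x
    have "ennreal ((1/2)^k) \<le> (\<Prod>i<?m. if (x, ys i) \<in> H then ennreal (1/2) else 1)" if "x \<in> B"
    proof -
      have "(\<Prod>i<?m. if (x, ys i) \<in> H then ennreal (1/2) else 1) = ennreal (1/2) ^ card {i. i < ?m \<and> (x, ys i) \<in> H}"
        by (simp add: prod.If_cases Int_def)
      also have "\<dots> = ennreal ((1/2) ^ card {i. i < ?m \<and> (x, ys i) \<in> H})"
        by (rule ennreal_power) simp
      finally show ?thesis
        using that by (auto simp: B_def simp del: ennreal_half intro!: ennreal_leI power_decreasing)
    qed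
    then show "ennreal ((1/2)^k) * indicator B x \<le> indicator A x * (\<Prod>i<?m. if (x, ys i) \<in> H then ennreal (1/2) else 1)"
      by (auto simp: indicator_def B_def simp del: ennreal_half)
  qed
  also note le
  also have "ennreal ((1 - q / 2) ^ ?m) * emeasure M A \<le> ennreal ((1/4)^k) * emeasure M A"
    using L q by (intro mult_right_mono ennreal_leI) (auto simp: power_mult intro!: power_mono)
  finally have 1: "ennreal ((1/2)^k) * emeasure M B \<le> ennreal ((1/4)^k) * emeasure M A" .
  have "emeasure M B = ennreal (2^k) * (ennreal ((1/2)^k) * emeasure M B)"
    by (simp add: mult.assoc[symmetric] power_one_over flip: ennreal_mult)
  also have "\<dots> \<le> ennreal (2^k) * (ennreal ((1/4)^k) * emeasure M A)"
    by (intro mult_left_mono 1) auto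
  also have "\<dots> = ennreal ((1/2)^k) * emeasure M A"
    by (simp add: mult.assoc[symmetric] flip: ennreal_mult power_mult_distrib)
  finally show ?thesis using ys \<open>B \<in> sets M\<close> unfolding B_def by blast
qed

section \<open>Reflections and step functions\<close>

text \<open>Converts the measure of the good points \<open>x - y\<close> of a ball into the measure
  of the shifts \<open>y\<close> that lead there.\<close>

lemma emeasure_lborel_reflect:
  fixes G :: "'a::euclidean_space set"
  assumes "G \<in> sets borel"
  shows "emeasure lborel {y. x - y \<in> G} = emeasure lborel G"
proof -
  have "{y. x - y \<in> G} = (\<lambda>z. (-1) *\<^sub>R z + x) ` G"
    by (force intro: image_eqI[where x="x - y" for y])
  moreover have "(\<lambda>y. x - y) -` G \<in> sets borel"
    by (rule measurable_sets_borel[OF _ assms]) measurable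
  then have "{y. x - y \<in> G} \<in> sets borel"
    by (simp add: vimage_def)
  ultimately show ?thesis
    using emeasure_lebesgue_affine[of "-1" x G] assms by simp
qed

definition step_fun :: "'i set \<Rightarrow> ('i \<Rightarrow> 'a set) \<Rightarrow> ('i \<Rightarrow> 's) \<Rightarrow> 'a \<Rightarrow> 's::real_normed_field"
  where "step_fun J Q c x = (\<Sum>j\<in>J. c j * indicator (Q j) x)"

lemma step_fun_eq:
  assumes "finite J" "disjoint_family_on Q J" "j \<in> J" "x \<in> Q j"
  shows "step_fun J Q c x = c j"
proof -
  have "step_fun J Q c x = (\<Sum>i\<in>J. if i = j then c j else 0)"
    unfolding step_fun_def
  proof (rule sum.cong)
    fix i assume "i \<in> J"
    then show "c i * indicator (Q i) x = (if i = j then c j else 0)"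
      using assms by (auto simp: disjoint_family_on_def indicator_def)
  qed simp
  then show ?thesis using assms by simp
qed

lemma step_fun_eq_0: "x \<notin> (\<Union>j\<in>J. Q j) \<Longrightarrow> step_fun J Q c x = 0"
  unfolding step_fun_def by (intro sum.neutral) auto

lemma step_fun_measurable:
  fixes c :: "'i \<Rightarrow> 's::{real_normed_field, euclidean_space}"
  assumes [measurable]: "\<And>j. j \<in> J \<Longrightarrow> Q j \<in> sets M"
  shows "step_fun J Q c \<in> borel_measurable M"
  unfolding step_fun_def[abs_def] by measurable

lemma borel_imp_lebesgue_measurable:
  "f \<in> borel_measurable borel \<Longrightarrow> f \<in> borel_measurable lebesgue"
  by (rule measurable_completion) simp

section \<open>Calculus of the norm\<close>

context banach_function_space
begin

text \<open>\<open>B1\<close> replaces both functions by their absolute values, to which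
  \<open>B2\<close> applies. Used in both directions, it shows that changes on null sets do not
  affect \<open>nrm\<close> as long as the functions are measurable.\<close>

lemma nrm_mono:
  assumes f: "f \<in> borel_measurable lebesgue" and g: "g \<in> borel_measurable lebesgue"
    and "AE x in lebesgue. norm (g x) \<le> norm (f x)"
  shows "nrm g \<le> nrm f"
proof -
  have "nrm (\<lambda>x. of_real (norm (g x))) \<le> nrm (\<lambda>x. of_real (norm (f x)))"
    using assms by (intro B2) auto
  then show ?thesis using B1[OF f] B1[OF g] by simp
qed

lemma nrm_zero: "nrm (\<lambda>x. 0) = 0"
  by (subst B0) auto

text \<open>Outside the carrier the right-hand side is infinite, so \<open>triangle\<close> extends
  to all measurable functions.\<close>

lemma nrm_add_le:
  assumes "f \<in> borel_measurable lebesgue" "g \<in> borel_measurable lebesgue"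
  shows "nrm (\<lambda>x. f x + g x) \<le> nrm f + nrm g"
proof (cases "nrm f = \<infinity> \<or> nrm g = \<infinity>")
  case False
  then show ?thesis
    using assms by (intro triangle) (auto simp: BFS_carrier_def less_top)
qed auto

lemma nrm_sum_le:
  assumes "finite I" "\<And>i. i \<in> I \<Longrightarrow> f i \<in> borel_measurable lebesgue"
  shows "nrm (\<lambda>x. \<Sum>i\<in>I. f i x) \<le> (\<Sum>i\<in>I. nrm (f i))"
  using assms
proof (induction I)
  case (insert i I)
  have "nrm (\<lambda>x. f i x + (\<Sum>i\<in>I. f i x)) \<le> nrm (f i) + nrm (\<lambda>x. \<Sum>i\<in>I. f i x)"
    using insert by (intro nrm_add_le borel_measurable_sum) auto
  also have "\<dots> \<le> nrm (f i) + (\<Sum>i\<in>I. nrm (f i))"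
    using insert by (intro add_left_mono) auto
  finally show ?case using insert by simp
qed (simp add: nrm_zero)

lemma nrm_scale_le:
  assumes "f \<in> borel_measurable lebesgue"
  shows "nrm (\<lambda>x. c * f x) \<le> ennreal (norm c) * nrm f"
proof (cases "c = 0 \<or> nrm f = \<infinity>")
  case True
  then show ?thesis
    by (cases "c = 0") (auto simp: nrm_zero ennreal_mult_top)
next
  case False
  then show ?thesis
    using assms by (subst scale) (auto simp: BFS_carrier_def less_top)
qed

section \<open>Domination on average and approximation by medians\<close>

text \<open>A substitute for Minkowski's integral inequality: averages over finitely many well-chosen \<open>y\<close>
  replace the integral over \<open>D\<close>, and the exceptional sets are absorbed by absolute continuity.\<close>

lemma nrm_le_if_frequently_dominated:
  fixes h :: "real ^ 'n \<Rightarrow> 's" and q :: real and D :: "(real ^ 'n) set"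
  assumes ac: "absolutely_continuous_norm nrm"
    and h: "h \<in> BFS_carrier nrm" "\<And>x. x \<notin> A \<Longrightarrow> h x = 0"
    and A[measurable]: "A \<in> sets lborel" and "emeasure lborel A < \<infinity>"
    and v: "\<And>y. y \<in> D \<Longrightarrow> v y \<in> borel_measurable lebesgue" "\<And>y. y \<in> D \<Longrightarrow> nrm (v y) \<le> \<eta>"
    and D[measurable]: "D \<in> sets lborel" and H: "H \<in> sets (lborel \<Otimes>\<^sub>M lborel)"
    and "0 < emeasure lborel D" "emeasure lborel D < \<infinity>" "0 < q" "q \<le> 1"
    and "\<And>x. x \<in> A \<Longrightarrow> ennreal (2 * q) * emeasure lborel D \<le> emeasure lborel {y \<in> D. (x, y) \<in> H}"
    and dom: "\<And>x y. x \<in> A \<Longrightarrow> (x, y) \<in> H \<Longrightarrow> norm (h x) \<le> norm (v y x)"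
    and L: "(1 - q / 2) ^ L \<le> 1 / 4"
  shows "nrm h \<le> of_nat L * \<eta>"
proof -
  define bad where "bad k ys = {x \<in> A. card {i. i < L * k \<and> (x, ys i) \<in> H} < k}" for k and ys :: "nat \<Rightarrow> real ^ 'n"
  have "\<exists>ys. (\<forall>i<L * k. ys i \<in> D) \<and> bad k ys \<in> sets lborel \<and>
    emeasure lborel (bad k ys) \<le> ennreal ((1/2)^k) * emeasure lborel A" for k
  proof -
    show ?thesis
      unfolding bad_def
      by (rule frequent_hits[OF A D H lborel.sigma_finite_measure_axioms assms(10,11,5,12-14) L, where k=k])
  qed
  from choice[OF allI[OF this]] obtain Y where
    "\<forall>k. (\<forall>i<L * k. Y k i \<in> D) \<and> bad k (Y k) \<in> sets lborel \<and>
      emeasure lborel (bad k (Y k)) \<le> ennreal ((1/2)^k) * emeasure lborel A" ..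
  then have Y: "\<And>k i. i < L * k \<Longrightarrow> Y k i \<in> D"
    and bad: "\<And>k. bad k (Y k) \<in> sets lborel"
    and bad_le: "\<And>k. emeasure lborel (bad k (Y k)) \<le> ennreal ((1/2)^k) * emeasure lborel A"
    by blast+
  define B where "B k = bad k (Y k)" for k
  have B[measurable]: "B k \<in> sets lebesgue" "B k \<in> sets lborel" for k
    using bad unfolding B_def by auto
  have hm[measurable]: "h \<in> borel_measurable lebesgue"
    using h by (auto simp: BFS_carrier_def)
  obtain a where a: "emeasure lborel A = ennreal a" "a \<ge> 0"
    using assms(5) by (cases "emeasure lborel A") auto
  have Ble: "emeasure lborel (B k) \<le> ennreal ((1/2)^k * a)" for k
    using bad_le[of k] a by (simp add: B_def ennreal_mult)
  \<comment> \<open>The measures of the \<open>B k\<close> are summable, so almost every point lies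
    in only finitely many of them. This is the convergence of sets that absolute continuity asks
    for.\<close>
  have "AE x in lborel. eventually (\<lambda>k. x \<in> space lborel - B k) sequentially"
  proof (rule borel_cantelli_AE1)
    show "emeasure lborel (B k) < \<infinity>" for k
      using Ble[of k] by (auto intro: le_less_trans)
    have le: "norm (measure lborel (B k)) \<le> (1/2)^k * a" for k
      unfolding real_norm_def abs_of_nonneg[OF measure_nonneg]
      unfolding measure_def using Ble[of k] a(2) by (intro enn2real_leI) auto
    have "summable (\<lambda>k. (1/2)^k * a)"
      by (intro summable_mult2 summable_geometric) simp
    then show "summable (\<lambda>k. measure lborel (B k))"
      by (rule summable_comparison_test') (rule le)
  qed (rule B)
  then have "AE x in lebesgue. eventually (\<lambda>k. x \<notin> B k) sequentially"
    by (intro AE_completion) auto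
  then have "AE x in lebesgue. (\<lambda>k. indicator (B k) x :: real) \<longlonglongrightarrow> 0"
  proof (rule AE_mp, intro AE_I2 impI)
    fix x assume "eventually (\<lambda>k. x \<notin> B k) sequentially"
    then show "(\<lambda>k. indicator (B k) x :: real) \<longlonglongrightarrow> 0"
      by (intro tendsto_eventually) (auto elim: eventually_mono)
  qed
  then have lim: "(\<lambda>k. nrm (\<lambda>x. h x * indicator (B k) x)) \<longlonglongrightarrow> 0"
    using ac h(1) B unfolding absolutely_continuous_norm_def by blast
  \<comment> \<open>At a point of \<open>A\<close> off \<open>B k\<close> at least \<open>k\<close>
    of the \<open>L * k\<close> shifts dominate \<open>h\<close>, so \<open>h\<close> is at most
    \<open>1 / k\<close> times the full sum. That sum has norm at most
    \<open>L * k * \<eta>\<close>, hence the bound is independent of \<open>k\<close>.\<close>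
  have good: "nrm (\<lambda>x. h x * indicator (- B k) x) \<le> of_nat L * \<eta>" if "k > 0" for k
  proof -
    let ?u = "\<lambda>i x. of_real (norm (v (Y k i) x)) :: 's"
    have um: "?u i \<in> borel_measurable lebesgue" if "i < L * k" for i
      using v(1)[OF Y[OF that]] by auto
    have Sm: "(\<lambda>x. \<Sum>i<L * k. ?u i x) \<in> borel_measurable lebesgue"
      using um by (intro borel_measurable_sum) auto
    have "nrm (\<lambda>x. h x * indicator (- B k) x) \<le> nrm (\<lambda>x. of_real (1 / real k) * (\<Sum>i<L * k. ?u i x))"
    proof (rule nrm_mono, use Sm in measurable, intro AE_I2)
      fix x
      show "norm (h x * indicator (- B k) x) \<le> norm (of_real (1 / real k) * (\<Sum>i<L * k. ?u i x))"
      proof (cases "x \<in> A - B k")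
        case True
        let ?I = "{i. i < L * k \<and> (x, Y k i) \<in> H}"
        have "real k * norm (h x) \<le> (\<Sum>i\<in>?I. norm (h x))"
          using True by (auto simp: B_def bad_def mult_right_mono)
        also have "\<dots> \<le> (\<Sum>i\<in>?I. norm (v (Y k i) x))"
          using dom True by (intro sum_mono) auto
        also have "\<dots> \<le> (\<Sum>i<L * k. norm (v (Y k i) x))"
          by (intro sum_mono2) auto
        finally have "norm (h x) \<le> (1 / real k) * (\<Sum>i<L * k. norm (v (Y k i) x))"
          using that by (simp add: field_simps)
        moreover have "norm (of_real (1 / real k) * (\<Sum>i<L * k. ?u i x)) = \<bar>1 / real k\<bar> * \<bar>\<Sum>i<L * k. norm (v (Y k i) x)\<bar>"
          by (simp only: norm_mult norm_of_real of_real_sum[symmetric])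
        ultimately show ?thesis
          using True by (simp add: sum_nonneg)
      qed (use h(2) in \<open>auto simp: indicator_def\<close>)
    qed
    also have "\<dots> \<le> ennreal (1 / real k) * nrm (\<lambda>x. \<Sum>i<L * k. ?u i x)"
      using nrm_scale_le[OF Sm, of "of_real (1 / real k)"] by (simp add: norm_divide)
    also have "nrm (\<lambda>x. \<Sum>i<L * k. ?u i x) \<le> (\<Sum>i<L * k. nrm (?u i))"
      using um by (intro nrm_sum_le) auto
    also have "\<dots> \<le> (\<Sum>i<L * k. \<eta>)"
    proof (rule sum_mono)
      fix i assume "i \<in> {..<L * k}"
      then have "Y k i \<in> D" using Y by auto
      then show "nrm (?u i) \<le> \<eta>" using v B1 by metis
    qed
    also have "ennreal (1 / real k) * (\<Sum>i<L * k. \<eta>) = of_nat L * \<eta>"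
    proof -
      have "ennreal (1 / real k) * of_nat k = 1"
        unfolding ennreal_of_nat_eq_real_of_nat using that
        by (subst ennreal_mult[symmetric]) auto
      then show ?thesis
        by (simp only: sum_constant card_lessThan of_nat_mult mult.commute[of "of_nat L"] mult.assoc[symmetric] mult_1_left)
    qed
    finally show ?thesis by (simp add: mult_left_mono)
  qed
  have "nrm h \<le> nrm (\<lambda>x. h x * indicator (B k) x) + of_nat L * \<eta>" if "k > 0" for k
  proof -
    have "nrm h = nrm (\<lambda>x. h x * indicator (B k) x + h x * indicator (- B k) x)"
      by (intro arg_cong[where f=nrm] ext) (auto simp: indicator_def)
    also have "\<dots> \<le> nrm (\<lambda>x. h x * indicator (B k) x) + nrm (\<lambda>x. h x * indicator (- B k) x)"
      by (intro nrm_add_le) measurable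
    also have "\<dots> \<le> nrm (\<lambda>x. h x * indicator (B k) x) + of_nat L * \<eta>"
      using good[OF that] by (rule add_left_mono)
    finally show ?thesis .
  qed
  then have ev: "eventually (\<lambda>k. nrm h \<le> nrm (\<lambda>x. h x * indicator (B k) x) + of_nat L * \<eta>) sequentially"
    by (auto simp: eventually_sequentially intro!: exI[of _ 1])
  \<comment> \<open>Letting \<open>k\<close> tend to infinity removes the contribution of the
    exceptional sets.\<close>
  have "(\<lambda>k. nrm (\<lambda>x. h x * indicator (B k) x) + of_nat L * \<eta>) \<longlonglongrightarrow> 0 + of_nat L * \<eta>"
    by (intro tendsto_add lim tendsto_const)
  from tendsto_lowerbound[OF this ev] show ?thesis by simp
qed

text \<open>The coefficients are approximate medians of \<open>f\<close> on the balls
  \<open>ball (z j) r\<close>. For \<open>x\<close> in \<open>Q j\<close>, the shifts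
  \<open>y\<close> with \<open>x - y\<close> in the good half of the ball give the domination, and
  their proportion in \<open>ball 0 (2 * r)\<close> is bounded below in terms of the dimension
  alone. \<open>f\<close> is Borel so that \<open>f (x - y)\<close> is jointly measurable.\<close>

lemma step_function_approximation:
  fixes f :: "real ^ 'n \<Rightarrow> 's" and \<epsilon> r \<eta> :: real
  assumes ac: "absolutely_continuous_norm nrm"
    and f[measurable]: "f \<in> borel_measurable borel" and fE: "f \<in> BFS_carrier nrm"
    and J: "finite J" and Q[measurable]: "\<And>j. j \<in> J \<Longrightarrow> Q j \<in> sets borel"
    and disj: "disjoint_family_on Q J" and Qz: "\<And>j. j \<in> J \<Longrightarrow> Q j \<subseteq> ball (z j) r"
    and "r > 0" "\<epsilon> > 0"
    and equi: "\<And>y. y \<in> ball 0 (2 * r) \<Longrightarrow> nrm (\<lambda>x. translate y f x - f x) \<le> ennreal \<eta>"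
    and L: "(1 - (1/2) ^ (CARD('n) + 3)) ^ L \<le> (1 / 4 :: real)"
  obtains c where
    "nrm (\<lambda>x. (f x - step_fun J Q c x) * indicator (\<Union>j\<in>J. Q j) x)
      \<le> of_nat L * (2 * ennreal \<eta> + ennreal (2 * \<epsilon>) * nrm (indicator (\<Union>j\<in>J. Q j)))"
proof -
  define A where "A = (\<Union>j\<in>J. Q j)"
  have A[measurable]: "A \<in> sets borel" unfolding A_def using J Q by auto
  have [measurable]: "A \<in> sets lebesgue" using A by simp
  have [measurable]: "f \<in> borel_measurable lebesgue"
    using f by (rule borel_imp_lebesgue_measurable)
  have "A \<subseteq> (\<Union>j\<in>J. ball (z j) r)" unfolding A_def using Qz by blast
  then have Ab: "bounded A"
    by (rule bounded_subset[rotated]) (use J in auto)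
  \<comment> \<open>The median is taken over the whole ball and not over \<open>Q j\<close>: a cell
    may be arbitrarily small compared with \<open>ball 0 (2 * r)\<close>, the ball is not.\<close>
  have "\<exists>c. \<forall>v. emeasure lborel (ball (z j) r) \<le> 2 * emeasure lborel {w \<in> ball (z j) r. dist v c \<le> 2 * dist v (f w) + 2 * \<epsilon>}" for j
  proof -
    have "emeasure lborel (ball (z j) r) < \<infinity>"
      by (rule emeasure_bounded_finite) simp
    then obtain c where "\<And>v. emeasure lborel (ball (z j) r) \<le> 2 * emeasure lborel {w \<in> ball (z j) r. dist v c \<le> 2 * dist v (f w) + 2 * \<epsilon>}"
      using approximate_median[of f lborel "ball (z j) r" \<epsilon>] f \<open>\<epsilon> > 0\<close> by auto
    then show ?thesis by blast
  qed
  from choice[OF allI[OF this]] obtain c where c: "\<forall>j v. emeasure lborel (ball (z j) r) \<le>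
      2 * emeasure lborel {w \<in> ball (z j) r. dist v (c j) \<le> 2 * dist v (f w) + 2 * \<epsilon>}" ..
  define g where "g = step_fun J Q c"
  have gm[measurable]: "g \<in> borel_measurable borel"
    unfolding g_def by (rule step_fun_measurable) auto
  then have [measurable]: "g \<in> borel_measurable lebesgue"
    by (rule borel_imp_lebesgue_measurable)
  have gQ: "g x = c j" if "x \<in> Q j" "j \<in> J" for x j
    unfolding g_def using step_fun_eq[OF J disj that(2,1)] .
  define h where "h x = (f x - g x) * indicator A x" for x
  have hm[measurable]: "h \<in> borel_measurable borel"
    unfolding h_def by measurable
  then have hml: "h \<in> borel_measurable lebesgue"
    by (rule borel_imp_lebesgue_measurable)
  \<comment> \<open>Absolute continuity can be applied to \<open>f - g\<close> on \<open>A\<close>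
    only if its norm is finite. For \<open>g\<close> this follows from \<open>B4\<close>, as
    \<open>g\<close> is bounded and \<open>A\<close> is a bounded set.\<close>
  have gA: "(\<lambda>x. g x * indicator A x) \<in> BFS_carrier nrm"
  proof -
    define K where "K = (\<Sum>j\<in>J. norm (c j))"
    have "nrm (\<lambda>x. g x * indicator A x) \<le> nrm (\<lambda>x. of_real K * indicator A x)"
    proof (rule nrm_mono)
      show "AE x in lebesgue. norm (g x * indicator A x) \<le> norm (of_real K * indicator A x :: 's)"
      proof (intro AE_I2)
        fix x
        have "norm (g x) \<le> \<bar>K\<bar>" if "x \<in> A"
        proof -
          obtain j where "j \<in> J" "x \<in> Q j" using \<open>x \<in> A\<close> unfolding A_def by blast
          then have "norm (g x) \<le> K" unfolding K_def using J gQ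
            by (auto intro!: member_le_sum)
          then show ?thesis by simp
        qed
        then show "norm (g x * indicator A x) \<le> norm (of_real K * indicator A x :: 's)"
          by (auto simp: indicator_def)
      qed
    qed measurable
    also have "\<dots> \<le> ennreal (norm (of_real K :: 's)) * nrm (indicator A)"
      by (rule nrm_scale_le) measurable
    also have "\<dots> < \<infinity>"
      using B4[of A] Ab by (auto simp: BFS_carrier_def ennreal_mult_less_top)
    finally show ?thesis by (auto simp: BFS_carrier_def)
  qed
  have hE: "h \<in> BFS_carrier nrm"
  proof -
    have "nrm h = nrm (\<lambda>x. f x * indicator A x + (- 1) * (g x * indicator A x))"
      unfolding h_def by (intro arg_cong[where f=nrm] ext) (simp add: algebra_simps)
    also have "\<dots> \<le> nrm (\<lambda>x. f x * indicator A x) + nrm (\<lambda>x. (- 1) * (g x * indicator A x))"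
      by (rule nrm_add_le) measurable
    also have "\<dots> \<le> nrm f + ennreal (norm (- 1 :: 's)) * nrm (\<lambda>x. g x * indicator A x)"
    proof (intro add_mono nrm_mono nrm_scale_le AE_I2)
      show "norm (f x * indicator A x) \<le> norm (f x)" for x
        by (simp add: indicator_def)
    qed measurable
    also have "\<dots> < \<infinity>" using fE gA by (auto simp: BFS_carrier_def)
    finally show ?thesis using hml by (auto simp: BFS_carrier_def)
  qed
  define H where "H = {p. fst p \<in> A \<and> norm (h (fst p)) \<le> 2 * norm (f (fst p - snd p) - f (fst p)) + 2 * \<epsilon>}"
  have "H = {p \<in> space (borel \<Otimes>\<^sub>M borel). fst p \<in> A \<and> norm (h (fst p)) \<le> 2 * norm (f (fst p - snd p) - f (fst p)) + 2 * \<epsilon>}"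
    by (auto simp: H_def space_pair_measure)
  also have "\<dots> \<in> sets (borel \<Otimes>\<^sub>M borel)"
    by measurable
  finally have Hm: "H \<in> sets (lborel \<Otimes>\<^sub>M lborel)" by simp
  \<comment> \<open>The factor \<open>indicator A\<close> is there because a nonzero constant need
    not have finite norm.\<close>
  define v where "v y x = (of_real (2 * norm (translate y f x - f x) + 2 * \<epsilon> * indicator A x) :: 's)" for y x
  have "nrm h \<le> of_nat L * (2 * ennreal \<eta> + ennreal (2 * \<epsilon>) * nrm (indicator A))"
  proof (rule nrm_le_if_frequently_dominated[OF ac hE, where A=A and D="ball 0 (2 * r)" and H=H and v=v and q="(1/2) ^ (CARD('n) + 2)"])
    fix y :: "real ^ 'n" assume y: "y \<in> ball 0 (2 * r)"
    have m[measurable]: "(\<lambda>x. translate y f x - f x) \<in> borel_measurable lebesgue"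
      unfolding translate_def by (rule borel_imp_lebesgue_measurable) measurable
    show "v y \<in> borel_measurable lebesgue" unfolding v_def by measurable
    have "nrm (v y) = nrm (\<lambda>x. 2 * of_real (norm (translate y f x - f x)) + of_real (2 * \<epsilon>) * indicator A x)"
      unfolding v_def by (intro arg_cong[where f=nrm] ext) (auto simp: indicator_def)
    also have "\<dots> \<le> nrm (\<lambda>x. 2 * of_real (norm (translate y f x - f x))) + nrm (\<lambda>x. of_real (2 * \<epsilon>) * indicator A x)"
      using m by (intro nrm_add_le) measurable
    also have "\<dots> \<le> ennreal (norm (2 :: 's)) * nrm (\<lambda>x. of_real (norm (translate y f x - f x)))
        + ennreal (norm (of_real (2 * \<epsilon>) :: 's)) * nrm (indicator A)"
      using m by (intro add_mono nrm_scale_le) measurable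
    also have "\<dots> \<le> 2 * ennreal \<eta> + ennreal (2 * \<epsilon>) * nrm (indicator A)"
      using equi[OF y] B1[OF m] \<open>\<epsilon> > 0\<close>
      by (intro add_mono) (auto intro!: mult_left_mono simp: norm_mult)
    finally show "nrm (v y) \<le> 2 * ennreal \<eta> + ennreal (2 * \<epsilon>) * nrm (indicator A)" .
  next
    fix x assume "x \<in> A"
    then obtain j where j: "j \<in> J" "x \<in> Q j" unfolding A_def by blast
    let ?G = "{w \<in> ball (z j) r. dist (f x) (c j) \<le> 2 * dist (f x) (f w) + 2 * \<epsilon>}"
    have G: "?G \<in> sets borel" by measurable
    \<comment> \<open>Both \<open>x\<close> and \<open>x - y\<close> lie in a ball of radius
      \<open>r\<close>, whence \<open>norm y < 2 * r\<close>; reflection preserves the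
      measure.\<close>
    have "{y. x - y \<in> ?G} \<subseteq> {y \<in> ball 0 (2 * r). (x, y) \<in> H}"
    proof safe
      fix y assume y: "x - y \<in> ball (z j) r" and d: "dist (f x) (c j) \<le> 2 * dist (f x) (f (x - y)) + 2 * \<epsilon>"
      have "x \<in> ball (z j) r" by (rule subsetD[OF Qz[OF j(1)] j(2)])
      moreover have "norm y \<le> norm (x - z j) + norm (x - y - z j)"
        using norm_triangle_ineq4[of "x - z j" "x - y - z j"] by simp
      ultimately show "y \<in> ball 0 (2 * r)"
        using y by (simp add: dist_norm norm_minus_commute)
      show "(x, y) \<in> H"
        using d \<open>x \<in> A\<close> gQ[OF j(2,1)] by (simp add: H_def h_def dist_norm norm_minus_commute)
    qed
    moreover have "{y \<in> ball 0 (2 * r). (x, y) \<in> H} \<in> sets lborel"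
    proof -
      have "{y \<in> ball 0 (2 * r). (x, y) \<in> H} = ball 0 (2 * r) \<inter> (Pair x -` H)" by auto
      also have "\<dots> \<in> sets lborel" using Hm by (intro sets.Int sets_Pair1) auto
      finally show ?thesis .
    qed
    ultimately have "emeasure lborel {y. x - y \<in> ?G} \<le> emeasure lborel {y \<in> ball 0 (2 * r). (x, y) \<in> H}"
      by (rule emeasure_mono)
    then have "emeasure lborel ?G \<le> emeasure lborel {y \<in> ball 0 (2 * r). (x, y) \<in> H}"
      unfolding emeasure_lborel_reflect[OF G] .
    then have "2 * emeasure lborel ?G \<le> 2 * emeasure lborel {y \<in> ball 0 (2 * r). (x, y) \<in> H}"
      by (rule mult_left_mono) simp
    with c have "emeasure lborel (ball (z j) r) \<le> 2 * emeasure lborel {y \<in> ball 0 (2 * r). (x, y) \<in> H}"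
      by (blast intro: order_trans)
    then have *: "ennreal (1/2) * emeasure lborel (ball (z j) r) \<le> ennreal (1/2) * (2 * emeasure lborel {y \<in> ball 0 (2 * r). (x, y) \<in> H})"
      by (rule mult_left_mono) simp
    \<comment> \<open>With \<open>n\<close> the dimension, \<open>ball (z j) r\<close> fills the
      fraction \<open>(1/2)^n\<close> of \<open>ball 0 (2 * r)\<close>, and the median keeps half of
      that: \<open>2 * q\<close> for \<open>q = (1/2)^(n + 2)\<close>. The exponent
      \<open>n + 3\<close> in the condition on \<open>L\<close> is that of
      \<open>q / 2\<close>.\<close>
    have "ennreal (2 * (1/2) ^ (CARD('n) + 2)) * emeasure lborel (ball (0 :: real ^ 'n) (2 * r))
        = ennreal (2 * (1/2) ^ (CARD('n) + 2) * (unit_ball_vol (real CARD('n)) * (2 * r) ^ CARD('n)))"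
      using \<open>r > 0\<close> by (subst ennreal_mult) (auto simp: emeasure_ball)
    also have "2 * (1/2) ^ (CARD('n) + 2) * (unit_ball_vol (real CARD('n)) * (2 * r) ^ CARD('n))
        = 1 / 2 * (unit_ball_vol (real CARD('n)) * r ^ CARD('n))"
      by (simp add: power_mult_distrib power_add power_one_over)
    also have "ennreal \<dots> = ennreal (1/2) * emeasure lborel (ball (z j) r)"
      using \<open>r > 0\<close> by (subst ennreal_mult) (auto simp: emeasure_ball)
    also note *
    also have "ennreal (1/2) * (2 * emeasure lborel {y \<in> ball 0 (2 * r). (x, y) \<in> H})
        = emeasure lborel {y \<in> ball 0 (2 * r). (x, y) \<in> H}"
    proof -
      have "ennreal (1/2) * 2 = 1"
        unfolding ennreal_numeral[symmetric] by (subst ennreal_mult[symmetric]) auto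
      then show ?thesis by (simp only: mult.assoc[symmetric] mult_1_left)
    qed
    finally show "ennreal (2 * (1/2) ^ (CARD('n) + 2)) * emeasure lborel (ball (0 :: real ^ 'n) (2 * r))
      \<le> emeasure lborel {y \<in> ball 0 (2 * r). (x, y) \<in> H}" .
  next
    fix x y assume "x \<in> A" "(x, y) \<in> H"
    then show "norm (h x) \<le> norm (v y x)"
      unfolding v_def norm_of_real using \<open>\<epsilon> > 0\<close> by (simp add: H_def translate_def)
  next
    show "emeasure lborel A < \<infinity>"
      using Ab by (rule emeasure_bounded_finite)
    have "(1/2) ^ (CARD('n) + 2) / 2 = (1/2 :: real) ^ (CARD('n) + 3)"
      by (simp add: numeral_3_eq_3)
    then show "(1 - (1/2) ^ (CARD('n) + 2) / 2) ^ L \<le> (1/4 :: real)"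
      using L by (simp only:)
    show "0 < emeasure lborel (ball (0 :: real ^ 'n) (2 * r))"
      using \<open>r > 0\<close> by (simp add: emeasure_ball)
    show "emeasure lborel (ball (0 :: real ^ 'n) (2 * r)) < \<infinity>"
      by (rule emeasure_bounded_finite) simp
    show "h x = 0" if "x \<notin> A" for x
      using that by (simp add: h_def)
    show "(1/2) ^ (CARD('n) + 2) \<le> (1 :: real)"
      by (rule power_le_one) auto
  qed (use A Hm in simp_all)
  then show ?thesis
    unfolding h_def g_def A_def by (rule that)
qed

end

section \<open>Borel representatives and partitions of balls\<close>

text \<open>The real-valued case is applied to each of the finitely many coordinates.\<close>

lemma lebesgue_measurable_ex_borel:
  fixes f :: "'a::euclidean_space \<Rightarrow> 'b::euclidean_space"
  assumes "f \<in> borel_measurable lebesgue"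
  obtains g where "g \<in> borel_measurable borel" "AE x in lebesgue. f x = g x"
proof -
  have "\<exists>h\<in>borel_measurable lborel. AE x in lborel. f x \<bullet> b = h x" for b
    using assms by (intro completion_ex_borel_measurable_real) simp
  then have "\<exists>h. h \<in> borel_measurable borel \<and> (AE x in lborel. f x \<bullet> b = h x)" for b
    by auto
  from choice[OF allI[OF this]] obtain h where
    h: "\<forall>b. h b \<in> borel_measurable borel \<and> (AE x in lborel. f x \<bullet> b = h b x)" ..
  have "AE x in lborel. \<forall>b\<in>Basis. f x \<bullet> b = h b x"
    using h by (intro AE_finite_allI) auto
  then have "AE x in lborel. f x = (\<Sum>b\<in>Basis. h b x *\<^sub>R b)"
  proof (rule AE_mp, intro AE_I2 impI)
    fix x assume "\<forall>b\<in>Basis. f x \<bullet> b = h b x"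
    then have "(\<Sum>b\<in>Basis. h b x *\<^sub>R b) = (\<Sum>b\<in>Basis. (f x \<bullet> b) *\<^sub>R b)"
      by (intro sum.cong) auto
    then show "f x = (\<Sum>b\<in>Basis. h b x *\<^sub>R b)"
      by (simp add: euclidean_representation)
  qed
  then have "AE x in lebesgue. f x = (\<Sum>b\<in>Basis. h b x *\<^sub>R b)"
    by (rule AE_completion)
  moreover have "(\<lambda>x. \<Sum>b\<in>Basis. h b x *\<^sub>R b) \<in> borel_measurable borel"
    using h by (intro borel_measurable_sum borel_measurable_scaleR) auto
  ultimately show ?thesis using that by blast
qed

text \<open>Translates of null sets are null. This lets equicontinuity pass from a function to its
  Borel representative.\<close>

lemma AE_lebesgue_translate:
  fixes P :: "'a::euclidean_space \<Rightarrow> bool"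
  assumes "AE x in lebesgue. P x"
  shows "AE x in lebesgue. P (x - y)"
proof -
  have "AE x in lborel. P x" using assms by (simp add: AE_completion_iff)
  then obtain N where N: "N \<in> null_sets lborel" "{x \<in> space lborel. \<not> P x} \<subseteq> N"
    unfolding eventually_ae_filter by blast
  have "{x \<in> space lborel. \<not> P (x - y)} \<subseteq> {x. x - y \<in> N}" using N(2) by auto
  then have "AE x in lborel. P (x - y)"
    unfolding eventually_ae_filter using null_sets_translation[OF N(1), of y] by blast
  then show ?thesis by (rule AE_completion)
qed

text \<open>A finite cover of the compact ball by balls of radius \<open>r\<close> is made disjoint
  and cut down to \<open>ball 0 N\<close>. Cells of measure zero are discarded, since coefficients
  are later bounded by dividing by the norm of \<open>indicator (Q j)\<close>; so the remaining
  cells cover only almost everywhere.\<close>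

lemma ball_partition:
  fixes N r :: real
  assumes "r > 0"
  obtains J :: "nat set" and Q and z :: "nat \<Rightarrow> 'a::euclidean_space"
  where "finite J" "\<forall>j. Q j \<in> sets borel" "disjoint_family_on Q J"
    "\<forall>j\<in>J. Q j \<subseteq> ball (z j) r" "\<forall>j. Q j \<subseteq> ball 0 N"
    "\<forall>j\<in>J. emeasure lborel (Q j) \<noteq> 0"
    "AE x in lebesgue. x \<in> ball 0 N \<longrightarrow> x \<in> (\<Union>j\<in>J. Q j)"
proof -
  have "compact (cball (0::'a) N)" by simp
  then obtain k where k: "finite k" "cball (0::'a) N \<subseteq> (\<Union>x\<in>k. ball x r)"
    using assms unfolding compact_eq_totally_bounded by blast
  obtain z n where z: "k = z ` {i::nat. i < n}"
    using finite_imp_nat_seg_image_inj_on[OF k(1)] by blast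
  define Q where "Q j = disjointed (\<lambda>i. ball (z i) r) j \<inter> ball 0 N" for j
  define J where "J = {j. j < n \<and> emeasure lborel (Q j) \<noteq> 0}"
  have Qm: "Q j \<in> sets borel" for j
    unfolding Q_def disjointed_def by auto
  have cover: "ball 0 N \<subseteq> (\<Union>j\<in>{0..<n}. Q j)"
  proof
    fix x :: 'a assume x: "x \<in> ball 0 N"
    then have "x \<in> (\<Union>x\<in>k. ball x r)" by (intro subsetD[OF k(2)]) simp
    then have "x \<in> (\<Union>i\<in>{0..<n}. ball (z i) r)" unfolding z by auto
    then have "x \<in> (\<Union>j\<in>{0..<n}. disjointed (\<lambda>i. ball (z i) r) j)"
      unfolding finite_UN_disjointed_eq .
    then show "x \<in> (\<Union>j\<in>{0..<n}. Q j)" using x unfolding Q_def by blast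
  qed
  have "(\<Union>j\<in>{0..<n} - J. Q j) \<in> null_sets lborel"
    using Qm by (intro null_sets_UN' countable_finite) (auto simp: J_def null_sets_def)
  then have "AE x in lborel. x \<notin> (\<Union>j\<in>{0..<n} - J. Q j)"
    by (rule AE_not_in)
  then have ae: "AE x in lebesgue. x \<in> ball 0 N \<longrightarrow> x \<in> (\<Union>j\<in>J. Q j)"
  proof (intro AE_completion, rule AE_mp, intro AE_I2 impI)
    fix x assume "x \<notin> (\<Union>j\<in>{0..<n} - J. Q j)" "x \<in> ball 0 N"
    then show "x \<in> (\<Union>j\<in>J. Q j)" using cover by blast
  qed
  show ?thesis
  proof (rule that[OF _ _ _ _ _ _ ae])
    show "finite J" unfolding J_def by simp
    show "disjoint_family_on Q J"
      using disjoint_family_disjointed[of "\<lambda>i. ball (z i) r"]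
      unfolding disjoint_family_on_def Q_def by blast
    show "\<forall>j. Q j \<in> sets borel" using Qm by blast
    have "Q j \<subseteq> ball (z j) r" for j
      unfolding Q_def using disjointed_subset[of "\<lambda>i. ball (z i) r" j] by blast
    then show "\<forall>j\<in>J. Q j \<subseteq> ball (z j) r" by simp
    show "\<forall>j. Q j \<subseteq> ball 0 N" unfolding Q_def by blast
    show "\<forall>j\<in>J. emeasure lborel (Q j) \<noteq> 0" unfolding J_def by simp
  qed
qed

section \<open>Coefficients of step functions and transfer of nets\<close>

context banach_function_space
begin

lemma nrm_indicator_finite:
  assumes "A \<in> sets borel" "bounded A"
  shows "nrm (indicator A) < \<infinity>"
  using B4[of A] assms by (simp add: BFS_carrier_def)

lemma nrm_indicator_pos:
  assumes "A \<in> sets borel" "emeasure lborel A \<noteq> 0"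
  shows "nrm (indicator A) \<noteq> 0"
proof
  assume "nrm (indicator A) = 0"
  moreover have "(indicator A :: real ^ 'n \<Rightarrow> 's) \<in> borel_measurable lebesgue"
    using assms by (intro borel_measurable_indicator) simp
  ultimately have "AE x in lebesgue. (indicator A x :: 's) = 0"
    by (simp only: B0)
  then have "AE x in lebesgue. x \<notin> A"
    by (rule AE_mp) (auto simp: indicator_def)
  then have "AE x in lborel. x \<notin> A"
    by (simp add: AE_completion_iff)
  then have "A \<in> null_sets lborel"
    using assms(1) by (simp add: AE_iff_null_sets)
  then show False using assms(2) by auto
qed

lemma nrm_step_fun_diff_le:
  assumes J: "finite J" and Q: "\<And>j. j \<in> J \<Longrightarrow> Q j \<in> sets borel" and disj: "disjoint_family_on Q J"
    and d: "\<And>j. j \<in> J \<Longrightarrow> norm (c j - t j) \<le> \<delta>" "0 \<le> \<delta>"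
  shows "nrm (\<lambda>x. step_fun J Q c x - step_fun J Q t x) \<le> ennreal \<delta> * nrm (indicator (\<Union>j\<in>J. Q j))"
proof -
  let ?A = "\<Union>j\<in>J. Q j"
  have A: "?A \<in> sets borel" using J Q by auto
  have m: "step_fun J Q u \<in> borel_measurable lebesgue" for u :: "_ \<Rightarrow> 's"
    using Q by (intro step_fun_measurable) auto
  have i: "(indicator ?A :: real ^ 'n \<Rightarrow> 's) \<in> borel_measurable lebesgue"
    using A by (intro borel_measurable_indicator) simp
  have "nrm (\<lambda>x. step_fun J Q c x - step_fun J Q t x) \<le> nrm (\<lambda>x. of_real \<delta> * indicator ?A x)"
  proof (rule nrm_mono)
    show "AE x in lebesgue. norm (step_fun J Q c x - step_fun J Q t x) \<le> norm (of_real \<delta> * indicator ?A x :: 's)"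
    proof (rule AE_I2)
      fix x
      show "norm (step_fun J Q c x - step_fun J Q t x) \<le> norm (of_real \<delta> * indicator ?A x :: 's)"
      proof (cases "x \<in> ?A")
        case True
        then obtain j where j: "j \<in> J" "x \<in> Q j" by blast
        show ?thesis
          using True d(1)[OF j(1)] d(2) by (simp only: step_fun_eq[OF J disj j]) (simp add: norm_mult)
      next
        case False
        then show ?thesis by (simp only: step_fun_eq_0[OF False]) simp
      qed
    qed
    show "(\<lambda>x. of_real \<delta> * indicator ?A x :: 's) \<in> borel_measurable lebesgue"
      by (rule borel_measurable_times[OF borel_measurable_const i])
    show "(\<lambda>x. step_fun J Q c x - step_fun J Q t x) \<in> borel_measurable lebesgue"
      by (rule borel_measurable_diff[OF m m])
  qed
  also have "\<dots> \<le> ennreal (norm (of_real \<delta> :: 's)) * nrm (indicator ?A)"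
    by (rule nrm_scale_le[OF i])
  finally show ?thesis using d(2) by simp
qed

text \<open>On \<open>Q j\<close> the number \<open>c j\<close> is \<open>f\<close> minus the
  approximation error. Comparing norms on this cell bounds the coefficient without any control of
  integrals of \<open>f\<close>.\<close>

lemma step_fun_coefficient_bound:
  assumes J: "finite J" and Q: "\<And>j. j \<in> J \<Longrightarrow> Q j \<in> sets borel" and disj: "disjoint_family_on Q J"
    and j: "j \<in> J" and b: "bounded (Q j)" and f: "f \<in> borel_measurable lebesgue"
  shows "ennreal (norm (c j)) * nrm (indicator (Q j)) \<le>
    nrm (\<lambda>x. (f x - step_fun J Q c x) * indicator (\<Union>j\<in>J. Q j) x) + nrm f"
proof -
  let ?h = "\<lambda>x. (f x - step_fun J Q c x) * indicator (\<Union>j\<in>J. Q j) x"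
  have A: "(\<Union>j\<in>J. Q j) \<in> sets borel" using J Q by auto
  have m: "step_fun J Q c \<in> borel_measurable lebesgue"
    using Q by (intro step_fun_measurable) auto
  have i: "(indicator B :: real ^ 'n \<Rightarrow> 's) \<in> borel_measurable lebesgue" if "B \<in> sets borel" for B
    using that by (intro borel_measurable_indicator) simp
  have h: "?h \<in> borel_measurable lebesgue"
    by (intro borel_measurable_times borel_measurable_diff f m i[OF A])
  have f': "(\<lambda>x. - f x) \<in> borel_measurable lebesgue"
    by (intro borel_measurable_uminus f)
  have "indicator (Q j) \<in> BFS_carrier nrm"
    using B4[of "Q j"] Q[OF j] b by simp
  then have "ennreal (norm (c j)) * nrm (indicator (Q j)) = nrm (\<lambda>x. c j * indicator (Q j) x)"
    by (rule scale[symmetric])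
  also have "\<dots> \<le> nrm (\<lambda>x. (?h x + - f x) * indicator (Q j) x)"
  proof (rule nrm_mono)
    show "(\<lambda>x. (?h x + - f x) * indicator (Q j) x) \<in> borel_measurable lebesgue"
      by (intro borel_measurable_times[OF borel_measurable_add[OF h f'] i[OF Q[OF j]]])
    show "(\<lambda>x. c j * indicator (Q j) x) \<in> borel_measurable lebesgue"
      by (intro borel_measurable_times borel_measurable_const i[OF Q[OF j]])
    show "AE x in lebesgue. norm (c j * indicator (Q j) x) \<le> norm ((?h x + - f x) * indicator (Q j) x)"
    proof (rule AE_I2)
      fix x
      show "norm (c j * indicator (Q j) x) \<le> norm ((?h x + - f x) * indicator (Q j) x)"
      proof (cases "x \<in> Q j")
        case True
        have "x \<in> (\<Union>j\<in>J. Q j)" using True j by blast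
        then show ?thesis using True by (simp add: step_fun_eq[OF J disj j True])
      qed simp
    qed
  qed
  also have "\<dots> \<le> nrm (\<lambda>x. ?h x + - f x)"
  proof (rule nrm_mono)
    show "(\<lambda>x. ?h x + - f x) \<in> borel_measurable lebesgue"
      by (rule borel_measurable_add[OF h f'])
    show "(\<lambda>x. (?h x + - f x) * indicator (Q j) x) \<in> borel_measurable lebesgue"
      by (rule borel_measurable_times[OF borel_measurable_add[OF h f'] i[OF Q[OF j]]])
    show "AE x in lebesgue. norm ((?h x + - f x) * indicator (Q j) x) \<le> norm (?h x + - f x)"
      by (rule AE_I2) (simp add: indicator_def)
  qed
  also have "\<dots> \<le> nrm ?h + nrm (\<lambda>x. - f x)"
    by (rule nrm_add_le[OF h f'])
  also have "nrm (\<lambda>x. - f x) \<le> nrm f"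
    by (rule nrm_mono[OF f f']) simp
  finally show ?thesis by (simp add: add_left_mono)
qed

text \<open>Net elements such as step functions may lie outside \<open>F\<close>. Each one that is
  close to \<open>F\<close> is replaced by a member of \<open>F\<close> near it, which doubles the
  radius; \<open>\<epsilon> / 3\<close> leaves room for the strict inequality.\<close>

lemma totally_bounded_if_nets:
  assumes F: "F \<subseteq> BFS_carrier nrm"
    and net: "\<And>e::real. e > 0 \<Longrightarrow> \<exists>G. finite G \<and> G \<subseteq> borel_measurable lebesgue \<and>
      (\<forall>f\<in>F. \<exists>g\<in>G. nrm (\<lambda>x. f x - g x) \<le> ennreal e)"
  shows "BFS_totally_bounded nrm F"
  unfolding BFS_totally_bounded_def
proof (intro conjI F allI impI)
  fix \<epsilon> :: real assume "\<epsilon> > 0"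
  then have "\<epsilon> / 3 > 0" by simp
  from net[OF this] obtain G where G: "finite G" "G \<subseteq> borel_measurable lebesgue"
    "\<And>f. f \<in> F \<Longrightarrow> \<exists>g\<in>G. nrm (\<lambda>x. f x - g x) \<le> ennreal (\<epsilon> / 3)"
    by blast
  define close where "close g f \<longleftrightarrow> f \<in> F \<and> nrm (\<lambda>x. f x - g x) \<le> ennreal (\<epsilon> / 3)" for g f
  define p where "p g = (SOME f. close g f)" for g
  have p: "close g (p g)" if "close g f" for g f
    unfolding p_def by (rule someI[of "close g", OF that])
  define K where "K = p ` {g \<in> G. \<exists>f. close g f}"
  have "finite K" unfolding K_def using G(1) by simp
  moreover have "K \<subseteq> F" unfolding K_def using p unfolding close_def by blast
  moreover have "\<exists>k\<in>K. nrm (\<lambda>x. f x - k x) < ennreal \<epsilon>" if f: "f \<in> F" for f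
  proof -
    obtain g where g: "g \<in> G" "close g f" using G(3)[OF f] f unfolding close_def by blast
    have pg: "close g (p g)" by (rule p[OF g(2)])
    have fm: "f \<in> borel_measurable lebesgue" "p g \<in> borel_measurable lebesgue" "g \<in> borel_measurable lebesgue"
      using f F pg g(1) G(2) unfolding close_def BFS_carrier_def by auto
    have 1: "(\<lambda>x. f x - g x) \<in> borel_measurable lebesgue"
      by (rule borel_measurable_diff[OF fm(1,3)])
    have 2: "(\<lambda>x. p g x - g x) \<in> borel_measurable lebesgue" "(\<lambda>x. g x - p g x) \<in> borel_measurable lebesgue"
      by (rule borel_measurable_diff[OF fm(2,3)], rule borel_measurable_diff[OF fm(3,2)])
    have "nrm (\<lambda>x. f x - p g x) = nrm (\<lambda>x. (f x - g x) + (g x - p g x))" by simp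
    also have "\<dots> \<le> nrm (\<lambda>x. f x - g x) + nrm (\<lambda>x. g x - p g x)"
      by (rule nrm_add_le[OF 1 2(2)])
    also have "\<dots> \<le> nrm (\<lambda>x. f x - g x) + nrm (\<lambda>x. p g x - g x)"
      by (intro add_left_mono nrm_mono 2) (simp add: norm_minus_commute)
    also have "\<dots> \<le> ennreal (\<epsilon> / 3) + ennreal (\<epsilon> / 3)"
      using g(2) pg unfolding close_def by (intro add_mono) auto
    also have "\<dots> = ennreal (\<epsilon> / 3 + \<epsilon> / 3)" using \<open>\<epsilon> > 0\<close> by (intro ennreal_plus[symmetric]) auto
    also have "\<dots> < ennreal \<epsilon>" using \<open>\<epsilon> > 0\<close> by (intro ennreal_lessI) auto
    finally have "nrm (\<lambda>x. f x - p g x) < ennreal \<epsilon>" .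
    moreover have "p g \<in> K" unfolding K_def using g by blast
    ultimately show ?thesis by blast
  qed
  ultimately show "\<exists>K. finite K \<and> K \<subseteq> F \<and> (\<forall>f\<in>F. \<exists>g\<in>K. nrm (\<lambda>x. f x - g x) < ennreal \<epsilon>)"
    by blast
qed

section \<open>Finite nets of step functions\<close>

text \<open>Three errors add up: the approximation on the cells, the rounding of coefficients to
  \<open>T j\<close>, and the part of \<open>f\<close> outside \<open>ball 0 N\<close>. Rounding is
  possible because \<open>step_fun_coefficient_bound\<close> puts the coefficients in the range of
  \<open>net\<close>.\<close>

lemma step_fun_near:
  fixes f :: "real ^ 'n \<Rightarrow> 's" and N r \<eta> \<epsilon> \<delta> :: real and J :: "nat set"
  assumes ac: "absolutely_continuous_norm nrm"
    and f: "f \<in> BFS_carrier nrm"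
    and J: "finite J" and Q: "\<And>j. Q j \<in> sets borel" and disj: "disjoint_family_on Q J"
    and Qz: "\<And>j. j \<in> J \<Longrightarrow> Q j \<subseteq> ball (z j) r" and QN: "\<And>j. Q j \<subseteq> ball 0 N"
    and ae: "AE x in lebesgue. x \<in> ball 0 N \<longrightarrow> x \<in> (\<Union>j\<in>J. Q j)"
    and "r > 0" "\<epsilon> > 0" "\<delta> \<ge> 0"
    and equi: "\<And>y. y \<in> ball 0 (2 * r) \<Longrightarrow> nrm (\<lambda>x. translate y f x - f x) \<le> ennreal \<eta>"
    and L: "(1 - (1/2) ^ (CARD('n) + 3)) ^ L \<le> (1 / 4 :: real)"
    and small: "of_nat L * (2 * ennreal \<eta> + ennreal (2 * \<epsilon>) * nrm (indicator (ball 0 N))) \<le> ennreal a"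
    and net: "\<And>c j. j \<in> J \<Longrightarrow> ennreal (norm c) * nrm (indicator (Q j)) \<le> ennreal a + nrm f \<Longrightarrow> \<exists>t\<in>T j. norm (c - t) \<le> \<delta>"
  obtains t where "t \<in> PiE J T"
    "nrm (\<lambda>x. f x - step_fun J Q t x) \<le>
      ennreal a + ennreal \<delta> * nrm (indicator (ball 0 N)) + nrm (\<lambda>x. f x * indicator (- ball 0 N) x)"
proof -
  let ?A = "\<Union>j\<in>J. Q j"
  have A: "?A \<in> sets borel" "?A \<subseteq> ball 0 N" using J Q QN by auto
  have i: "(indicator B :: real ^ 'n \<Rightarrow> 's) \<in> borel_measurable lebesgue" if "B \<in> sets borel" for B
    using that by (intro borel_measurable_indicator) simp
  have iA: "nrm (indicator ?A) \<le> nrm (indicator (ball 0 N))"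
  proof (rule nrm_mono[OF i i])
    show "AE x in lebesgue. norm (indicator ?A x :: 's) \<le> norm (indicator (ball 0 N) x :: 's)"
      using A(2) by (intro AE_I2) (auto simp only: indicator_def split: if_splits, auto)
  qed (use A in simp_all)
  have fm: "f \<in> borel_measurable lebesgue" using f by (simp add: BFS_carrier_def)
  \<comment> \<open>The approximation is applied to a Borel representative, whose norm and
    translation differences do not exceed those of \<open>f\<close>.\<close>
  obtain f0 where f0: "f0 \<in> borel_measurable borel" and eq: "AE x in lebesgue. f x = f0 x"
    using lebesgue_measurable_ex_borel[OF fm] by blast
  have f0m: "f0 \<in> borel_measurable lebesgue" by (rule borel_imp_lebesgue_measurable[OF f0])
  have f0_le: "nrm f0 \<le> nrm f"
    by (rule nrm_mono[OF fm f0m]) (use eq in \<open>auto elim: AE_mp\<close>)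
  have f0E: "f0 \<in> BFS_carrier nrm"
    using f0m f0_le f by (auto simp: BFS_carrier_def)
  have equi0: "nrm (\<lambda>x. translate y f0 x - f0 x) \<le> ennreal \<eta>" if y: "y \<in> ball 0 (2 * r)" for y
  proof -
    have m0: "(\<lambda>x. translate y f0 x - f0 x) \<in> borel_measurable lebesgue"
      unfolding translate_def by (rule borel_imp_lebesgue_measurable) (use f0 in measurable)
    have ae0: "AE x in lebesgue. translate y f0 x - f0 x = translate y f x - f x"
      using AE_lebesgue_translate[OF eq, of y] eq unfolding translate_def
      by (rule AE_mp[OF AE_conjI]) simp
    \<comment> \<open>Inherited from the Borel difference, since Lebesgue measure is
      complete.\<close>
    have m: "(\<lambda>x. translate y f x - f x) \<in> borel_measurable lebesgue"
      by (rule borel_measurable_AE[OF m0 ae0])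
    have "nrm (\<lambda>x. translate y f0 x - f0 x) \<le> nrm (\<lambda>x. translate y f x - f x)"
      by (rule nrm_mono[OF m m0]) (rule AE_mp[OF ae0], simp)
    also have "\<dots> \<le> ennreal \<eta>" by (rule equi[OF y])
    finally show ?thesis .
  qed
  obtain c where c: "nrm (\<lambda>x. (f0 x - step_fun J Q c x) * indicator ?A x)
      \<le> of_nat L * (2 * ennreal \<eta> + ennreal (2 * \<epsilon>) * nrm (indicator ?A))"
    by (rule step_function_approximation[OF ac f0 f0E J Q disj Qz \<open>r > 0\<close> \<open>\<epsilon> > 0\<close> equi0 L])
  also have "\<dots> \<le> of_nat L * (2 * ennreal \<eta> + ennreal (2 * \<epsilon>) * nrm (indicator (ball 0 N)))"
    by (intro mult_left_mono add_left_mono iA) simp_all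
  also note small
  finally have ca: "nrm (\<lambda>x. (f0 x - step_fun J Q c x) * indicator ?A x) \<le> ennreal a" .
  have "\<exists>t\<in>T j. norm (c j - t) \<le> \<delta>" if j: "j \<in> J" for j
  proof (rule net[OF j])
    have "bounded (Q j)" using QN[of j] by (rule bounded_subset[OF bounded_ball])
    then have "ennreal (norm (c j)) * nrm (indicator (Q j)) \<le>
        nrm (\<lambda>x. (f0 x - step_fun J Q c x) * indicator ?A x) + nrm f0"
      by (intro step_fun_coefficient_bound[OF J Q disj j _ f0m])
    also have "\<dots> \<le> ennreal a + nrm f" by (intro add_mono ca f0_le)
    finally show "ennreal (norm (c j)) * nrm (indicator (Q j)) \<le> ennreal a + nrm f" .
  qed
  then have "\<forall>j\<in>J. \<exists>t. t \<in> T j \<and> norm (c j - t) \<le> \<delta>" by blast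
  from bchoice[OF this] obtain t0 where t0: "\<forall>j\<in>J. t0 j \<in> T j \<and> norm (c j - t0 j) \<le> \<delta>" ..
  \<comment> \<open>Restriction puts the rounded coefficients into \<open>PiE J T\<close>, which is
    finite as soon as every \<open>T j\<close> is.\<close>
  define t where "t = restrict t0 J"
  have t: "t \<in> PiE J T" "\<And>j. j \<in> J \<Longrightarrow> norm (c j - t j) \<le> \<delta>"
    unfolding t_def using t0 by auto
  have sm: "step_fun J Q u \<in> borel_measurable lebesgue" for u :: "nat \<Rightarrow> 's"
    using Q by (intro step_fun_measurable) auto
  let ?h1 = "\<lambda>x. (f0 x - step_fun J Q c x) * indicator ?A x"
  let ?h2 = "\<lambda>x. step_fun J Q c x - step_fun J Q t x"
  let ?h3 = "\<lambda>x. f x * indicator (- ball 0 N) x"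
  have m1: "?h1 \<in> borel_measurable lebesgue"
    by (intro borel_measurable_times borel_measurable_diff f0m sm i A)
  have m2: "?h2 \<in> borel_measurable lebesgue"
    by (intro borel_measurable_diff sm)
  have m3: "?h3 \<in> borel_measurable lebesgue"
    by (intro borel_measurable_times fm i) simp
  have m12: "(\<lambda>x. ?h1 x + ?h2 x) \<in> borel_measurable lebesgue"
    by (rule borel_measurable_add[OF m1 m2])
  have m: "(\<lambda>x. f x - step_fun J Q t x) \<in> borel_measurable lebesgue"
    by (rule borel_measurable_diff[OF fm sm])
  \<comment> \<open>The two functions agree almost everywhere: on the cells \<open>?h1\<close> and
    \<open>?h2\<close> telescope, outside \<open>ball 0 N\<close> only \<open>?h3\<close> survives,
    and the rest is a null set.\<close>
  have "nrm (\<lambda>x. f x - step_fun J Q t x) \<le> nrm (\<lambda>x. (?h1 x + ?h2 x) + ?h3 x)"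
  proof (rule nrm_mono[OF borel_measurable_add[OF m12 m3] m])
    show "AE x in lebesgue. norm (f x - step_fun J Q t x) \<le> norm (?h1 x + ?h2 x + ?h3 x)"
      using eq ae
    proof (rule AE_mp[OF AE_conjI], intro AE_I2 impI)
      fix x assume x: "f x = f0 x \<and> (x \<in> ball 0 N \<longrightarrow> x \<in> ?A)"
      show "norm (f x - step_fun J Q t x) \<le> norm (?h1 x + ?h2 x + ?h3 x)"
      proof (cases "x \<in> ?A")
        case True
        then have "x \<in> ball 0 N" using A(2) by blast
        then show ?thesis using True x by (simp only: indicator_simps Compl_iff) simp
      next
        case False
        then have "x \<notin> ball 0 N" using x by blast
        then show ?thesis using False by (simp add: step_fun_eq_0[OF False] indicator_def)
      qed
    qed
  qed
  also have "\<dots> \<le> nrm (\<lambda>x. ?h1 x + ?h2 x) + nrm ?h3"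
    by (rule nrm_add_le[OF m12 m3])
  also have "\<dots> \<le> (nrm ?h1 + nrm ?h2) + nrm ?h3"
    by (rule add_right_mono[OF nrm_add_le[OF m1 m2]])
  also have "\<dots> \<le> (ennreal a + ennreal \<delta> * nrm (indicator (ball 0 N))) + nrm ?h3"
  proof (intro add_right_mono add_mono ca)
    have "nrm ?h2 \<le> ennreal \<delta> * nrm (indicator ?A)"
      by (rule nrm_step_fun_diff_le[OF J Q disj t(2) \<open>\<delta> \<ge> 0\<close>])
    also have "\<dots> \<le> ennreal \<delta> * nrm (indicator (ball 0 N))"
      by (intro mult_left_mono iA) simp
    finally show "nrm ?h2 \<le> ennreal \<delta> * nrm (indicator (ball 0 N))" .
  qed
  finally show ?thesis by (rule that[OF t(1)])
qed

text \<open>The choices are made in the order \<open>N\<close>, \<open>L\<close>,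
  \<open>\<eta>\<close>, \<open>r\<close>, cells, coefficient nets. Each depends only on earlier
  ones and on \<open>F\<close> as a whole, never on a single \<open>f\<close>, so one finite set
  serves all of \<open>F\<close>.\<close>

lemma finite_net:
  fixes e :: real
  assumes ac: "absolutely_continuous_norm nrm"
    and F: "F \<subseteq> BFS_carrier nrm"
    and bounded: "(SUP f\<in>F. nrm f) < \<infinity>"
    and vanishing: "((\<lambda>N::real. SUP f\<in>F. nrm (\<lambda>x. f x * indicator (- ball 0 N) x)) \<longlongrightarrow> 0) at_top"
    and equicontinuous:
      "((\<lambda>r::real. SUP f\<in>F. SUP y\<in>ball 0 r. nrm (\<lambda>x. translate y f x - f x)) \<longlongrightarrow> 0) (at_right 0)"
    and "e > 0"
  shows "\<exists>G. finite G \<and> G \<subseteq> borel_measurable lebesgue \<and> (\<forall>f\<in>F. \<exists>g\<in>G. nrm (\<lambda>x. f x - g x) \<le> ennreal e)"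
proof -
  have "eventually (\<lambda>N::real. (SUP f\<in>F. nrm (\<lambda>x. f x * indicator (- ball 0 N) x)) < ennreal (e / 4)) at_top"
    using vanishing \<open>e > 0\<close> by (intro order_tendstoD(2)) auto
  then obtain N :: real where N: "(SUP f\<in>F. nrm (\<lambda>x. f x * indicator (- ball 0 N) x)) < ennreal (e / 4)"
    by (auto dest: eventually_happens)
  have tail: "nrm (\<lambda>x. f x * indicator (- ball 0 N) x) \<le> ennreal (e / 4)" if "f \<in> F" for f
    using SUP_upper[OF that, of "\<lambda>f. nrm (\<lambda>x. f x * indicator (- ball 0 N) x)"] N
    by (rule order_trans[OF _ less_imp_le])
  have "nrm (indicator (ball 0 N)) < \<infinity>" by (rule nrm_indicator_finite) auto
  then obtain b where b: "nrm (indicator (ball 0 N)) = ennreal b" "b \<ge> 0"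
    by (cases "nrm (indicator (ball 0 N))") auto
  obtain C where C: "(SUP f\<in>F. nrm f) = ennreal C" "C \<ge> 0"
    using bounded by (cases "SUP f\<in>F. nrm f") auto
  have fC: "nrm f \<le> ennreal C" if "f \<in> F" for f
    unfolding C(1)[symmetric] by (rule SUP_upper[OF that])
  have "\<exists>L. (1 - (1/2) ^ (CARD('n) + 3)) ^ L < (1 / 4 :: real)"
    by (rule real_arch_pow_inv) auto
  then obtain L where L: "(1 - (1/2) ^ (CARD('n) + 3)) ^ L \<le> (1 / 4 :: real)"
    using less_imp_le by blast
  \<comment> \<open>These give \<open>L * (2 * \<eta> + 2 * \<epsilon> * b) \<le> 4 * L * \<eta>
    \<le> e / 2\<close> and \<open>\<delta> * b \<le> e / 4\<close>; with the tail
    \<open>e / 4\<close> the errors sum to at most \<open>e\<close>. The summands 1 keep the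
    denominators positive.\<close>
  define \<eta> where "\<eta> = e / (8 * (real L + 1))"
  define \<epsilon> where "\<epsilon> = \<eta> / (b + 1)"
  define \<delta> where "\<delta> = e / (4 * (b + 1))"
  have "\<eta> > 0" unfolding \<eta>_def using \<open>e > 0\<close> by simp
  then have pos: "\<eta> > 0" "\<epsilon> > 0" "\<delta> > 0"
    unfolding \<epsilon>_def \<delta>_def using \<open>e > 0\<close> b(2) by simp_all
  have "real L * (2 * \<eta> + 2 * \<epsilon> * b) \<le> e / 2"
  proof -
    have "\<epsilon> * b \<le> \<eta>"
      unfolding \<epsilon>_def using b(2) pos(1) by (simp add: field_simps)
    then have "real L * (2 * \<eta> + 2 * \<epsilon> * b) \<le> real L * (4 * \<eta>)"
      by (intro mult_left_mono) auto
    also have "\<dots> \<le> (real L + 1) * (4 * \<eta>)"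
      using pos(1) by (intro mult_right_mono) auto
    also have "\<dots> = e / 2"
      unfolding \<eta>_def by (simp add: divide_simps)
    finally show ?thesis .
  qed
  moreover have "of_nat L * (2 * ennreal \<eta> + ennreal (2 * \<epsilon>) * nrm (indicator (ball 0 N))) = ennreal (real L * (2 * \<eta> + 2 * \<epsilon> * b))"
  proof -
    have "2 * ennreal \<eta> = ennreal (2 * \<eta>)"
      unfolding ennreal_numeral[symmetric] by (rule ennreal_mult[symmetric]) (use pos(1) in auto)
    moreover have "ennreal (2 * \<epsilon>) * ennreal b = ennreal (2 * \<epsilon> * b)"
      using pos(2) b(2) by (intro ennreal_mult[symmetric]) auto
    moreover have "ennreal (2 * \<eta>) + ennreal (2 * \<epsilon> * b) = ennreal (2 * \<eta> + 2 * \<epsilon> * b)"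
      using pos b(2) by (intro ennreal_plus[symmetric]) auto
    moreover have "ennreal (real L) * ennreal (2 * \<eta> + 2 * \<epsilon> * b) = ennreal (real L * (2 * \<eta> + 2 * \<epsilon> * b))"
      using pos b(2) by (intro ennreal_mult[symmetric]) auto
    ultimately show ?thesis
      by (simp only: b(1) ennreal_of_nat_eq_real_of_nat)
  qed
  ultimately have small: "of_nat L * (2 * ennreal \<eta> + ennreal (2 * \<epsilon>) * nrm (indicator (ball 0 N))) \<le> ennreal (e / 2)"
    by (simp only: ennreal_leI)
  have "ennreal \<delta> * nrm (indicator (ball 0 N)) = ennreal (\<delta> * b)"
    unfolding b(1) using pos b(2) by (simp add: ennreal_mult)
  moreover have "\<delta> * b \<le> e / 4"
    unfolding \<delta>_def using b(2) \<open>e > 0\<close> by (simp add: field_simps)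
  ultimately have \<delta>b: "ennreal \<delta> * nrm (indicator (ball 0 N)) \<le> ennreal (e / 4)"
    by (simp only: ennreal_leI)
  have "eventually (\<lambda>r::real. (SUP f\<in>F. SUP y\<in>ball 0 r. nrm (\<lambda>x. translate y f x - f x)) < ennreal \<eta>) (at_right 0)"
    using equicontinuous pos(1) by (intro order_tendstoD(2)) auto
  then obtain \<rho> :: real where \<rho>: "\<rho> > 0" "\<And>s. 0 < s \<Longrightarrow> s < \<rho> \<Longrightarrow>
      (SUP f\<in>F. SUP y\<in>ball 0 s. nrm (\<lambda>x. translate y f x - f x)) < ennreal \<eta>"
    unfolding eventually_at_right_field by blast
  \<comment> \<open>Shifts between two points of one ball have length up to \<open>2 * r\<close>,
    which has to stay below \<open>\<rho>\<close>.\<close>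
  define r where "r = \<rho> / 4"
  have r: "r > 0" "(SUP f\<in>F. SUP y\<in>ball 0 (2 * r). nrm (\<lambda>x. translate y f x - f x)) < ennreal \<eta>"
    using \<rho>(1) by (auto simp: r_def intro!: \<rho>(2))
  have equi: "nrm (\<lambda>x. translate y f x - f x) \<le> ennreal \<eta>" if "f \<in> F" "y \<in> ball 0 (2 * r)" for f y
  proof -
    have "nrm (\<lambda>x. translate y f x - f x) \<le> (SUP y\<in>ball 0 (2 * r). nrm (\<lambda>x. translate y f x - f x))"
      by (rule SUP_upper[OF that(2)])
    also have "\<dots> \<le> (SUP f\<in>F. SUP y\<in>ball 0 (2 * r). nrm (\<lambda>x. translate y f x - f x))"
      by (rule SUP_upper[OF that(1)])
    also note less_imp_le[OF r(2)]
    finally show ?thesis .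
  qed
  obtain J :: "nat set" and Q and z :: "nat \<Rightarrow> real ^ 'n" where
    J: "finite J" and Q': "\<forall>j. Q j \<in> sets borel" and disj: "disjoint_family_on Q J"
    and Qz': "\<forall>j\<in>J. Q j \<subseteq> ball (z j) r" and QN': "\<forall>j. Q j \<subseteq> ball 0 N"
    and Q0: "\<forall>j\<in>J. emeasure lborel (Q j) \<noteq> 0"
    and ae: "AE x in lebesgue. x \<in> ball 0 N \<longrightarrow> x \<in> (\<Union>j\<in>J. Q j)"
    by (rule ball_partition[OF r(1), where N=N])
  note Q = Q'[rule_format] and Qz = Qz'[rule_format] and QN = QN'[rule_format]
  \<comment> \<open>Bounds the coefficient on \<open>Q j\<close> for all members of \<open>F\<close>
    at once: \<open>e / 2\<close> is the approximation error, \<open>C\<close> the norm bound of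
    \<open>F\<close>. For \<open>j\<close> in \<open>J\<close> the denominator is positive because
    null cells were discarded.\<close>
  define R where "R j = (e / 2 + C) / enn2real (nrm (indicator (Q j)))" for j
  have cR: "norm c \<le> R j" if j: "j \<in> J" and le: "ennreal (norm c) * nrm (indicator (Q j)) \<le> ennreal (e / 2) + ennreal C" for c :: 's and j
  proof -
    have "nrm (indicator (Q j)) < \<infinity>" "nrm (indicator (Q j)) \<noteq> 0"
      using nrm_indicator_finite[OF Q bounded_subset[OF bounded_ball QN]] nrm_indicator_pos[OF Q Q0[rule_format, OF j]] by auto
    then obtain d where d: "nrm (indicator (Q j)) = ennreal d" "d > 0"
      by (cases "nrm (indicator (Q j))") (auto simp: less_le)
    have "ennreal (norm c * d) \<le> ennreal (e / 2 + C)"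
      using le d C(2) \<open>e > 0\<close> by (simp add: ennreal_mult ennreal_plus)
    then have "norm c * d \<le> e / 2 + C"
      using C(2) \<open>e > 0\<close> by (subst (asm) ennreal_le_iff) auto
    then show ?thesis using d by (simp add: R_def field_simps)
  qed
  \<comment> \<open>The scalars form a finite-dimensional space, so a closed ball of coefficients is
    compact.\<close>
  have "\<exists>T. finite T \<and> cball (0 :: 's) (R j) \<subseteq> (\<Union>x\<in>T. ball x \<delta>)" for j
    using compact_cball[of "0 :: 's" "R j"] pos(3) unfolding compact_eq_totally_bounded by blast
  from choice[OF allI[OF this]] obtain T where
    T: "\<forall>j. finite (T j) \<and> cball (0 :: 's) (R j) \<subseteq> (\<Union>x\<in>T j. ball x \<delta>)" ..
  have net: "\<exists>t\<in>T j. norm (c - t) \<le> \<delta>" if j: "j \<in> J" and f: "f \<in> F"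
    and le: "ennreal (norm c) * nrm (indicator (Q j)) \<le> ennreal (e / 2) + nrm f" for c j f
  proof -
    have "ennreal (norm c) * nrm (indicator (Q j)) \<le> ennreal (e / 2) + ennreal C"
      using le by (rule order_trans) (rule add_left_mono[OF fC[OF f]])
    then have "c \<in> cball 0 (R j)" using cR[OF j] by simp
    then obtain t where "t \<in> T j" "c \<in> ball t \<delta>" using T by blast
    then show ?thesis by (auto simp: dist_norm norm_minus_commute intro!: bexI[of _ t])
  qed
  define G where "G = step_fun J Q ` PiE J T"
  have "finite G"
    unfolding G_def using J T by (intro finite_imageI finite_PiE) auto
  moreover have "G \<subseteq> borel_measurable lebesgue"
  proof -
    have "step_fun J Q u \<in> borel_measurable lebesgue" for u :: "nat \<Rightarrow> 's"
      using Q by (intro step_fun_measurable) auto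
    then show ?thesis unfolding G_def by blast
  qed
  moreover have "\<exists>g\<in>G. nrm (\<lambda>x. f x - g x) \<le> ennreal e" if f: "f \<in> F" for f
  proof -
    obtain t where t: "t \<in> PiE J T" and le: "nrm (\<lambda>x. f x - step_fun J Q t x) \<le>
      ennreal (e / 2) + ennreal \<delta> * nrm (indicator (ball 0 N)) + nrm (\<lambda>x. f x * indicator (- ball 0 N) x)"
      by (rule step_fun_near[OF ac subsetD[OF F f] J Q disj Qz QN ae r(1) pos(2) less_imp_le[OF pos(3)]
          equi[OF f] L small net[OF _ f]])
    note le
    also have "ennreal (e / 2) + ennreal \<delta> * nrm (indicator (ball 0 N)) + nrm (\<lambda>x. f x * indicator (- ball 0 N) x)
      \<le> ennreal (e / 2) + ennreal (e / 4) + ennreal (e / 4)"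
      by (intro add_mono \<delta>b tail f order_refl)
    also have "\<dots> = ennreal (e / 2 + e / 4 + e / 4)"
      using \<open>e > 0\<close> by (simp only: ennreal_plus[symmetric] add_nonneg_nonneg divide_nonneg_nonneg less_imp_le zero_le_numeral)
    also have "e / 2 + e / 4 + e / 4 = e" by simp
    finally show ?thesis using t unfolding G_def by blast
  qed
  ultimately show ?thesis by blast
qed

end

theorem theorem3p1:
  fixes nrm :: "(real ^ 'n \<Rightarrow> 's :: {real_normed_field, euclidean_space}) \<Rightarrow> ennreal"
    and F :: "(real ^ 'n \<Rightarrow> 's) set"
  assumes "banach_function_space nrm"
    and "absolutely_continuous_norm nrm"
    and "F \<subseteq> BFS_carrier nrm"
    and bounded: "(SUP f\<in>F. nrm f) < \<infinity>"
    and vanishing: "((\<lambda>N::real. SUP f\<in>F. nrm (\<lambda>x. f x * indicator (- ball 0 N) x)) \<longlongrightarrow> 0) at_top"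
    and equicontinuous:
      "((\<lambda>r::real. SUP f\<in>F. SUP y\<in>ball 0 r. nrm (\<lambda>x. translate y f x - f x)) \<longlongrightarrow> 0) (at_right 0)"
  shows "BFS_totally_bounded nrm F"
proof -
  interpret banach_function_space nrm by fact
  show ?thesis
  proof (rule totally_bounded_if_nets[OF assms(3)])
    fix e :: real assume "e > 0"
    then show "\<exists>G. finite G \<and> G \<subseteq> borel_measurable lebesgue \<and> (\<forall>f\<in>F. \<exists>g\<in>G. nrm (\<lambda>x. f x - g x) \<le> ennreal e)"
      by (rule finite_net[OF assms(2-6)])
  qed
qed

end
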